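(* Let $k,s\ge 1$ be integers, let $\alpha_{[n-\ell]}^{i,j},\beta_{[n-\ell]}^{i,j}\ge 0$ be the coefficients of a multistep multistage method, and let $\varphi:\mathbb{R}\to\mathbb{R}$ be at least continuously differentiable with $\varphi(h)=h+O(h^2)$ for sufficiently small $h$. Assume that the general linear forms of the methods below are covariant. Then the nonstandard multistep multistage method $$y_{[n-1]}^{(1)}=y_{n-1},$$ $$y_{[n-1]}^{(i)}=\sum_{\ell=2}^k\sum_{j=1}^{s}\Big(\alpha_{[n-\ell]}^{i,j}y_{[n-\ell]}^{(j)}+\beta_{[n-\ell]}^{i,j}\varphi(\Delta t)f\big(y_{[n-\ell]}^{(j)}\big)\Big)+\sum_{j=1}^{i-1}\Big(\alpha_{[n-1]}^{i,j}y_{[n-1]}^{(j)}+\beta_{[n-1]}^{i,j}\varphi(\Delta t)f\big(y_{[n-1]}^{(j)}\big)\Big)\quad(i=2,\dots,s+1),$$ $$y_n=y_{[n-1]}^{(s+1)}$$ is convergent if and only if its standard counterpart, i.e. the method with the same coefficients in which $\varphi(\Delta t)$ is replaced by $\Delta t$, is convergent.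
   Context: Problem: $x'(t)=f(x(t))$, $x(t_0)=\tilde x$, with $x:[t_0,T]\to\mathbb{R}^N$, $f:\mathbb{R}^N\to\mathbb{R}^N$, $\tilde x\in\mathbb{R}^N$, under conditions ensuring a unique solution. Grid: $t_n=t_0+n\Delta t$, $n=0,\dots,\mathcal N$, $t_{\mathcal N}=T$, $\Delta t>0$, $\mathcal N>k$; $y_n\approx x(t_n)$. The coefficients $\alpha_{[n-\ell]}^{i,j},\beta_{[n-\ell]}^{i,j}$ depend on $\ell,i,j$ only (not on $n$). Standing assumptions on the problem: (P1) there is a closed set $S\subset\mathbb{R}^N$ such that $\tilde x\in S$ implies $x(t)\in S$ for all $t\in[t_0,T]$; (P2) there are $M,L>0$ with $\|z\|\le M$ and $\|f(z)\|\le LM$ for all $z\in S$; (P3) $\|f(z_1)-f(z_2)\|\le L\|z_1-z_2\|$ for all $z_1,z_2\in S$. General linear form: put $Y_{[n]}=\big((y_{[n]}^{(1)})^T,\dots,(y_{[n]}^{(s+1)})^T\big)^T$ and let $f(Y_{[n]})$ be the vector collecting all $f(y_{[n]}^{(i)})$. The method is regarded as a one-step recursion for the vector $$g_{[n-1]}=\big(Y_{[n-k+1]}^T,\dots,Y_{[n-1]}^T,\ \tau f(Y_{[n-k+1]})^T,\dots,\tau f(Y_{[n-1]})^T\big)^T,$$ with $\tau=\varphi(\Delta t)$ for the nonstandard and $\tau=\Delta t$ for the standard method (for $k=1$ take the single stage vector $Y_{[n-1]}$ and $\tau f(Y_{[n-1]})$). Let $r$ be the number of $\mathbb{R}^N$-valued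 blocks $g^{1},\dots,g^{r}$ of this vector. Convergence: the method is convergent if for any initial value problem $x'(t)=f(x(t))$, $x(t_0)=\tilde x$, with $x:[t_0,T]\to\mathbb{R}^N$, $f:\mathbb{R}^N\to\mathbb{R}^N$, $\tilde x\in\mathbb{R}^N$, under conditions ensuring a unique solution, there exist a non-zero vector $u\in\mathbb{R}^r$ and a starting procedure $\psi$ on $(0,\infty)$, with blocks $\psi_i(\Delta t)\in\mathbb{R}^N$, $i=1,\dots,r$, such that $\lim_{\Delta t\to0}\psi_i(\Delta t)=u_ix(t_0)$ for all $i$, and such that for any $\hat t\in(t_0,T]$ the vectors $g_{[n]}$, computed using $n$ steps with stepsize $\Delta t=(\hat t-t_0)/n$ from $g_{[0]}=\psi(\Delta t)$, converge to $u\,x(\hat t)$ (blocks $u_ix(\hat t)$) as $n\to\infty$. Covariance: the method, applied to $x_1'=f(x_1)$, $x_1(t_0)=x_0$, and to $x_2'=f(x_2-\eta)$, $x_2(t_0)=x_0+\eta$, produces the same numerical solution shifted by $\eta$: if each $g_{[0]}^i$ is shifted by $u_i\eta$, then each $g_{[1]}^i$ is shifted by $u_i\eta$ and each internal stage by $\eta$. *)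

theory Defs
  imports "HOL-Analysis.Analysis" "HOL-Library.Landau_Symbols"
begin

text \<open>
  Coefficients: \<open>\<alpha> l i j\<close> and \<open>\<beta> l i j\<close> are the coefficients with subscript \<open>[n-l]\<close> and superscripts
  \<open>i,j\<close>.  They occur for \<open>2 \<le> i \<le> s+1\<close> and either \<open>2 \<le> l \<le> k\<close>, \<open>1 \<le> j \<le> s\<close>, or \<open>l = 1\<close>, \<open>1 \<le> j < i\<close>.
\<close>

type_synonym coeffs = "nat \<Rightarrow> nat \<Rightarrow> nat \<Rightarrow> real"

definition nonneg_coeffs :: "nat \<Rightarrow> nat \<Rightarrow> coeffs \<Rightarrow> bool" where
  "nonneg_coeffs k s \<gamma> \<longleftrightarrow>
     (\<forall>i\<in>{2..s+1}. (\<forall>l\<in>{2..k}. \<forall>j\<in>{1..s}. 0 \<le> \<gamma> l i j) \<and> (\<forall>j\<in>{1..<i}. 0 \<le> \<gamma> 1 i j))"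

text \<open>
  The equations of the method for a sequence \<open>y\<close> of grid values and the stages \<open>Y n i\<close> (the \<open>i\<close>-th
  stage with subscript \<open>[n]\<close>), where \<open>\<tau>\<close> is the factor of \<open>f\<close>.
\<close>

definition method_eqs ::
  "coeffs \<Rightarrow> coeffs \<Rightarrow> nat \<Rightarrow> nat \<Rightarrow> real \<Rightarrow> ('v::real_vector \<Rightarrow> 'v) \<Rightarrow> (nat \<Rightarrow> 'v) \<Rightarrow> (nat \<Rightarrow> nat \<Rightarrow> 'v)
     \<Rightarrow> nat \<Rightarrow> bool"
  where
  "method_eqs \<alpha> \<beta> k s \<tau> f y Y n \<longleftrightarrow>
     Y (n-1) 1 = y (n-1) \<and>
     (\<forall>i\<in>{2..s+1}. Y (n-1) i =
        (\<Sum>l=2..k. \<Sum>j=1..s. \<alpha> l i j *\<^sub>R Y (n-l) j + \<beta> l i j *\<^sub>R (\<tau> *\<^sub>R f (Y (n-l) j)))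
      + (\<Sum>j=1..<i. \<alpha> 1 i j *\<^sub>R Y (n-1) j + \<beta> 1 i j *\<^sub>R (\<tau> *\<^sub>R f (Y (n-1) j)))) \<and>
     y n = Y (n-1) (s+1)"

text \<open>
  Names for the blocks of the vector of the general linear form.  In the vector with subscript \<open>[n]\<close>,
  \<open>Val q j\<close> is the \<open>j\<close>-th stage with subscript \<open>[n-q]\<close>, and \<open>Slope q j\<close> is \<open>\<tau>\<close> times \<open>f\<close> of that stage.
  A vector with \<open>r\<close> blocks is a function on the finite set \<open>blocks k s\<close>, which has \<open>r\<close> elements; its
  values outside this set are irrelevant.
\<close>

datatype block = Val nat nat | Slope nat nat

definition depth :: "nat \<Rightarrow> nat" where
  "depth k = max (k - 1) 1"

definition blocks :: "nat \<Rightarrow> nat \<Rightarrow> block set" where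
  "blocks k s = {Val q j |q j. q < depth k \<and> j \<in> {1..s+1}} \<union> {Slope q j |q j. q < depth k \<and> j \<in> {1..s+1}}"

text \<open>
  \<open>gl_stage \<dots> g i\<close> is the \<open>i\<close>-th stage computed from the input vector \<open>g\<close>.  The coefficients with
  subscript \<open>[n-l]\<close> meet blocks of age \<open>l-2\<close>, because the newest stages in \<open>g\<close> have subscript \<open>[n-2]\<close>
  when the stages with subscript \<open>[n-1]\<close> are computed.
\<close>

fun gl_stage ::
  "coeffs \<Rightarrow> coeffs \<Rightarrow> nat \<Rightarrow> nat \<Rightarrow> real \<Rightarrow> ('v::real_vector \<Rightarrow> 'v) \<Rightarrow> (block \<Rightarrow> 'v) \<Rightarrow> nat \<Rightarrow> 'v"
  where
  "gl_stage \<alpha> \<beta> k s \<tau> f g i =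
     (if i \<le> 1 then g (Val 0 (s+1))
      else (\<Sum>l=2..k. \<Sum>j=1..s. \<alpha> l i j *\<^sub>R g (Val (l-2) j) + \<beta> l i j *\<^sub>R g (Slope (l-2) j))
         + (\<Sum>j=1..<i. \<alpha> 1 i j *\<^sub>R gl_stage \<alpha> \<beta> k s \<tau> f g j
                     + \<beta> 1 i j *\<^sub>R (\<tau> *\<^sub>R f (gl_stage \<alpha> \<beta> k s \<tau> f g j))))"

declare gl_stage.simps [simp del]

fun gl_step ::
  "coeffs \<Rightarrow> coeffs \<Rightarrow> nat \<Rightarrow> nat \<Rightarrow> real \<Rightarrow> ('v::real_vector \<Rightarrow> 'v) \<Rightarrow> (block \<Rightarrow> 'v) \<Rightarrow> block \<Rightarrow> 'v"
  where
  "gl_step \<alpha> \<beta> k s \<tau> f g (Val 0 j) = gl_stage \<alpha> \<beta> k s \<tau> f g j"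
| "gl_step \<alpha> \<beta> k s \<tau> f g (Val (Suc q) j) = g (Val q j)"
| "gl_step \<alpha> \<beta> k s \<tau> f g (Slope 0 j) = \<tau> *\<^sub>R f (gl_stage \<alpha> \<beta> k s \<tau> f g j)"
| "gl_step \<alpha> \<beta> k s \<tau> f g (Slope (Suc q) j) = g (Slope q j)"

fun gl_vector :: "real \<Rightarrow> ('v::real_vector \<Rightarrow> 'v) \<Rightarrow> (nat \<Rightarrow> nat \<Rightarrow> 'v) \<Rightarrow> nat \<Rightarrow> block \<Rightarrow> 'v" where
  "gl_vector \<tau> f Y n (Val q j) = Y (n-q) j"
| "gl_vector \<tau> f Y n (Slope q j) = \<tau> *\<^sub>R f (Y (n-q) j)"

text \<open>
  The conditions ensuring a unique solution: \<open>f\<close> is locally Lipschitz continuous and the trajectory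
  stays in a closed set on which \<open>f\<close> has the stated bounds.  The Lipschitz condition is not confined to
  \<open>S\<close>, because the method evaluates \<open>f\<close> at points that need not belong to \<open>S\<close>.
\<close>

definition admissible_ivp ::
  "(real^'N \<Rightarrow> real^'N) \<Rightarrow> real \<Rightarrow> real \<Rightarrow> real^'N \<Rightarrow> (real \<Rightarrow> real^'N) \<Rightarrow> bool" where
  "admissible_ivp f t0 T x0 x \<longleftrightarrow>
     t0 < T \<and> x t0 = x0 \<and>
     (\<forall>t\<in>{t0..T}. (x has_vector_derivative f (x t)) (at t within {t0..T})) \<and>
     local_lipschitz {t0..T} UNIV (\<lambda>_. f) \<and>
     (\<exists>S M L. closed S \<and> x0 \<in> S \<and> (\<forall>t\<in>{t0..T}. x t \<in> S) \<and>
        M > 0 \<and> L > 0 \<and> (\<forall>z\<in>S. norm z \<le> M \<and> norm (f z) \<le> L * M) \<and>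
        (\<forall>z1\<in>S. \<forall>z2\<in>S. norm (f z1 - f z2) \<le> L * norm (z1 - z2)))"

text \<open>
  In the following two definitions the factor of \<open>f\<close> at stepsize \<open>h\<close> is \<open>\<theta> h\<close>: \<open>\<theta> = \<phi>\<close> gives the
  nonstandard and \<open>\<theta> = (\<lambda>h. h)\<close> the standard method.
\<close>

definition gl_convergent ::
  "'N::finite itself \<Rightarrow> coeffs \<Rightarrow> coeffs \<Rightarrow> nat \<Rightarrow> nat \<Rightarrow> (real \<Rightarrow> real) \<Rightarrow> bool" where
  "gl_convergent TYPE('N) \<alpha> \<beta> k s \<theta> \<longleftrightarrow>
     (\<forall>(f :: real^'N \<Rightarrow> real^'N) t0 T x0 x. admissible_ivp f t0 T x0 x \<longrightarrow>
       (\<exists>(u :: block \<Rightarrow> real) (\<psi> :: real \<Rightarrow> block \<Rightarrow> real^'N).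
          (\<exists>b\<in>blocks k s. u b \<noteq> 0) \<and>
          (\<forall>b\<in>blocks k s. ((\<lambda>h. \<psi> h b) \<longlongrightarrow> u b *\<^sub>R x t0) (at_right 0)) \<and>
          (\<forall>t\<in>{t0<..T}. \<forall>b\<in>blocks k s.
             (\<lambda>n. let h = (t - t0) / real n in
                    (gl_step \<alpha> \<beta> k s (\<theta> h) f ^^ n) (\<psi> h) b) \<longlonglongrightarrow> u b *\<^sub>R x t)))"

definition gl_covariant ::
  "'N::finite itself \<Rightarrow> coeffs \<Rightarrow> coeffs \<Rightarrow> nat \<Rightarrow> nat \<Rightarrow> (real \<Rightarrow> real) \<Rightarrow> bool" where
  "gl_covariant TYPE('N) \<alpha> \<beta> k s \<theta> \<longleftrightarrow>
     (\<exists>u :: block \<Rightarrow> real. \<forall>(f :: real^'N \<Rightarrow> real^'N) \<eta> h g1 g2. h > 0 \<longrightarrow>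
        (\<forall>b\<in>blocks k s. g2 b = g1 b + u b *\<^sub>R \<eta>) \<longrightarrow>
        (\<forall>b\<in>blocks k s. gl_step \<alpha> \<beta> k s (\<theta> h) (\<lambda>z. f (z - \<eta>)) g2 b
                        = gl_step \<alpha> \<beta> k s (\<theta> h) f g1 b + u b *\<^sub>R \<eta>) \<and>
        (\<forall>i\<in>{1..s+1}. gl_stage \<alpha> \<beta> k s (\<theta> h) (\<lambda>z. f (z - \<eta>)) g2 i
                        = gl_stage \<alpha> \<beta> k s (\<theta> h) f g1 i + \<eta>))"

lemma card_blocks: "card (blocks k s) = 2 * depth k * (s+1)"
proof -
  let ?I = "{..<depth k} \<times> {1..s+1}"
  have eq: "blocks k s = case_prod Val ` ?I \<union> case_prod Slope ` ?I"
    unfolding blocks_def by (auto simp: image_iff)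
  have "inj_on (case_prod Val) ?I" "inj_on (case_prod Slope) ?I"
    by (auto simp: inj_on_def)
  then have "card (case_prod Val ` ?I) = card ?I" "card (case_prod Slope ` ?I) = card ?I"
    by (simp_all only: card_image)
  moreover have "card (case_prod Val ` ?I \<union> case_prod Slope ` ?I)
      = card (case_prod Val ` ?I) + card (case_prod Slope ` ?I)"
    by (rule card_Un_disjoint) auto
  moreover have "card ?I = depth k * (s+1)"
    by (simp add: card_cartesian_product)
  ultimately show ?thesis
    unfolding eq by (simp only: mult_2 distrib_right)
qed

text \<open>Solutions of the equations of the method, packed into vectors, follow the one-step recursion.\<close>

lemma gl_stage_gl_vector:
  assumes "method_eqs \<alpha> \<beta> k s \<tau> f y Y (n-1)" "method_eqs \<alpha> \<beta> k s \<tau> f y Y n"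
    and "2 \<le> n" "k \<le> n" "i \<in> {1..s+1}"
  shows "gl_stage \<alpha> \<beta> k s \<tau> f (gl_vector \<tau> f Y (n-2)) i = Y (n-1) i"
  using assms(5)
proof (induction i rule: less_induct)
  case (less i)
  have n: "n - 1 - 1 = n - 2" by simp
  show ?case
  proof (cases "i = 1")
    case True
    then show ?thesis
      using assms(1,2) n by (subst gl_stage.simps) (simp add: method_eqs_def)
  next
    case False
    then have i: "i \<in> {2..s+1}" using less.prems by auto
    let ?g = "gl_vector \<tau> f Y (n-2)"
    have old: "(\<Sum>l=2..k. \<Sum>j=1..s. \<alpha> l i j *\<^sub>R ?g (Val (l-2) j) + \<beta> l i j *\<^sub>R ?g (Slope (l-2) j))
        = (\<Sum>l=2..k. \<Sum>j=1..s. \<alpha> l i j *\<^sub>R Y (n-l) j + \<beta> l i j *\<^sub>R (\<tau> *\<^sub>R f (Y (n-l) j)))"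
    proof (intro sum.cong refl)
      fix l j assume "l \<in> {2..k}"
      then have "n - 2 - (l - 2) = n - l" using assms(3,4) by auto
      then show "\<alpha> l i j *\<^sub>R ?g (Val (l-2) j) + \<beta> l i j *\<^sub>R ?g (Slope (l-2) j)
          = \<alpha> l i j *\<^sub>R Y (n-l) j + \<beta> l i j *\<^sub>R (\<tau> *\<^sub>R f (Y (n-l) j))"
        by (simp only: gl_vector.simps)
    qed
    have new: "(\<Sum>j=1..<i. \<alpha> 1 i j *\<^sub>R gl_stage \<alpha> \<beta> k s \<tau> f ?g j
                        + \<beta> 1 i j *\<^sub>R (\<tau> *\<^sub>R f (gl_stage \<alpha> \<beta> k s \<tau> f ?g j)))
        = (\<Sum>j=1..<i. \<alpha> 1 i j *\<^sub>R Y (n-1) j + \<beta> 1 i j *\<^sub>R (\<tau> *\<^sub>R f (Y (n-1) j)))"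
      using less by (intro sum.cong refl) auto
    have "\<not> i \<le> 1" using i by auto
    then have "gl_stage \<alpha> \<beta> k s \<tau> f ?g i =
        (\<Sum>l=2..k. \<Sum>j=1..s. \<alpha> l i j *\<^sub>R Y (n-l) j + \<beta> l i j *\<^sub>R (\<tau> *\<^sub>R f (Y (n-l) j)))
      + (\<Sum>j=1..<i. \<alpha> 1 i j *\<^sub>R Y (n-1) j + \<beta> 1 i j *\<^sub>R (\<tau> *\<^sub>R f (Y (n-1) j)))"
      by (subst gl_stage.simps) (simp only: old new if_False)
    also have "\<dots> = Y (n-1) i"
      using assms(2) i by (simp only: method_eqs_def)
    finally show ?thesis .
  qed
qed

lemma gl_step_gl_vector:
  assumes "method_eqs \<alpha> \<beta> k s \<tau> f y Y (n-1)" "method_eqs \<alpha> \<beta> k s \<tau> f y Y n"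
    and "2 \<le> n" "k \<le> n" "b \<in> blocks k s"
  shows "gl_step \<alpha> \<beta> k s \<tau> f (gl_vector \<tau> f Y (n-2)) b = gl_vector \<tau> f Y (n-1) b"
proof -
  obtain q j where b: "b = Val q j \<or> b = Slope q j" and j: "j \<in> {1..s+1}"
    using assms(5) unfolding blocks_def by blast
  have shift: "n - 2 - q' = n - 1 - Suc q'" for q'
    by simp
  have stage: "gl_stage \<alpha> \<beta> k s \<tau> f (gl_vector \<tau> f Y (n-2)) j = Y (n-1) j"
    by (rule gl_stage_gl_vector[OF assms(1-4) j])
  show ?thesis
    using b by (cases q) (auto simp only: gl_step.simps gl_vector.simps stage shift diff_zero)
qed

end

theory Submission
  imports Defs
begin

text \<open>
  Applied to \<open>f = 0\<close>, covariance says that the coefficients \<open>\<alpha>\<close> of every stage sum to 1.  Being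
  nonnegative, they form convex combinations, so the recursion is stable in a weighted maximum norm
  for every choice of the factor.  Two runs from the same starting vector with the factors
  \<open>\<theta> h\<close> and \<open>\<theta>' h\<close> differ in each step by \<open>O(\<bar>\<theta> h - \<theta>' h\<bar>) = O(h\<^sup>2)\<close>, hence after \<open>n = O(1/h)\<close> steps
  by \<open>O(h)\<close>, and one converges if the other does.  As \<open>f\<close> is only locally Lipschitz, this needs a
  bound on the whole convergent run.  Runs with the same number of steps depend on the end point in an
  equicontinuous way, so that convergence at each end point is uniform, which yields the bound.
\<close>

section \<open>Stepsizes and factors near zero\<close>

lemma stepsize_at_right: "0 < a \<Longrightarrow> filterlim (\<lambda>n. a / real n) (at_right 0) sequentially"
  by (auto simp: filterlim_at intro: lim_const_over_n eventually_mono[OF eventually_gt_at_top[of 0]])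

lemma eventually_at_right_0_less: "0 < c \<Longrightarrow> \<forall>\<^sub>F h in at_right 0. 0 < h \<and> h < (c::real)"
  unfolding eventually_at_right_field by auto

text \<open>Once \<open>C * h\<close> is at most 1, the error \<open>C * h\<^sup>2\<close> is at
  most \<open>h\<close>, which confines the factor to the interval from 0 to \<open>2 * h\<close>.
  The stability estimates need the sign, and the upper end explains the factors 2 in later
  constants.\<close>

lemma factor_bounds:
  fixes \<theta> :: "real \<Rightarrow> real"
  assumes "(\<lambda>h. \<theta> h - h) \<in> O[at_right 0](\<lambda>h. h\<^sup>2)"
  obtains C where "0 < C" "\<forall>\<^sub>F h in at_right 0. 0 \<le> \<theta> h \<and> \<theta> h \<le> 2 * h \<and> \<bar>\<theta> h - h\<bar> \<le> C * h\<^sup>2"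
proof -
  obtain C where C: "0 < C" and le: "\<forall>\<^sub>F h in at_right 0. norm (\<theta> h - h) \<le> C * norm (h\<^sup>2)"
    using landau_o.bigE[OF assms] .
  have "\<forall>\<^sub>F h in at_right 0. 0 < h \<and> h < 1 / C"
    using C by (intro eventually_at_right_0_less) simp
  with le have "\<forall>\<^sub>F h in at_right 0. 0 \<le> \<theta> h \<and> \<theta> h \<le> 2 * h \<and> \<bar>\<theta> h - h\<bar> \<le> C * h\<^sup>2"
  proof eventually_elim
    case (elim h)
    have "C * h\<^sup>2 = (C * h) * h" by (simp add: power2_eq_square)
    also have "\<dots> \<le> 1 * h"
      using elim C by (intro mult_right_mono) (auto simp: field_simps)
    finally show ?case using elim by auto
  qed
  with C that show thesis by blast
qed

text \<open>Serves to cut a run at the end of a time slice. Cutting after the floor of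
  \<open>d / h\<close> steps falls short of \<open>d\<close> by less than one step, and
  \<open>h \<le> \<delta>\<close> turns this loss into the second \<open>\<delta>\<close>.\<close>

lemma split_steps:
  fixes h d \<delta> :: real
  assumes h: "0 < h" "h \<le> \<delta>" and d: "0 \<le> d" and m: "real m * h \<le> d + \<delta>"
  obtains i where "i \<le> m" "real i * h \<le> d" "real (m - i) * h \<le> 2 * \<delta>"
proof -
  define n where "n = nat \<lfloor>d / h\<rfloor>"
  have "real n \<le> d / h" "d / h < real n + 1"
    using h d by (auto simp: n_def)
  then have n: "real n * h \<le> d" "d < (real n + 1) * h"
    using h by (auto simp: pos_le_divide_eq pos_divide_less_eq)
  show thesis
  proof (cases "m \<le> n")
    case True
    then have "real m * h \<le> real n * h" using h by (intro mult_right_mono) auto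
    with n(1) have "real m * h \<le> d" by linarith
    then show thesis using h by (intro that[of m]) auto
  next
    case False
    then have "real (m - n) * h = real m * h - real n * h"
      by (simp add: of_nat_diff left_diff_distrib)
    then show thesis using False n m h by (intro that[of n]) (auto simp: distrib_right)
  qed
qed

section \<open>A weighted norm on vectors of blocks\<close>

locale stochastic_method =
  fixes \<alpha> \<beta> :: coeffs and k s :: nat and b :: real
  assumes alpha_nonneg: "nonneg_coeffs k s \<alpha>"
    and row_sum: "i \<in> {2..s+1} \<Longrightarrow> (\<Sum>l=2..k. \<Sum>j=1..s. \<alpha> l i j) + (\<Sum>j=1..<i. \<alpha> 1 i j) = 1"
    and beta_bound: "l \<in> {1..k} \<Longrightarrow> i \<in> {2..s+1} \<Longrightarrow> j \<in> {1..s+1} \<Longrightarrow> \<bar>\<beta> l i j\<bar> \<le> b"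
    and b_ge_1: "1 \<le> b"
    and k_ge_1: "1 \<le> k"
begin

definition slopes :: "(block \<Rightarrow> 'v::real_normed_vector) \<Rightarrow> nat \<Rightarrow> real" where
  "slopes g q = (\<Sum>j=1..s+1. norm (g (Slope q j)))"

definition vals :: "(block \<Rightarrow> 'v::real_normed_vector) \<Rightarrow> real" where
  "vals g = Max ((\<lambda>(q,j). norm (g (Val q j))) ` ({..<depth k} \<times> {1..s+1}))"

text \<open>Values are measured by a maximum, because convex combinations do not increase it; slopes
  are added to the stages, hence the sum. Each step of ageing lowers a weight by
  \<open>real (s+1) * b\<close>, the most that the slope can add to a stage before Lipschitz growth.
  Since \<open>b \<ge> 1\<close>, all weights are at least 1 and \<open>gnorm\<close> dominates
  every block.\<close>

definition gnorm :: "(block \<Rightarrow> 'v::real_normed_vector) \<Rightarrow> real" where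
  "gnorm g = vals g + (\<Sum>q<depth k. real (s+1) * b * real (depth k - q) * slopes g q)"

lemma depth_pos: "0 < depth k"
  by (simp add: depth_def)

lemma norm_le_vals: "q < depth k \<Longrightarrow> j \<in> {1..s+1} \<Longrightarrow> norm (g (Val q j)) \<le> vals g"
  unfolding vals_def by (rule Max_ge) (auto intro!: rev_image_eqI)

lemma vals_le: "(\<And>q j. q < depth k \<Longrightarrow> j \<in> {1..s+1} \<Longrightarrow> norm (g (Val q j)) \<le> c) \<Longrightarrow> vals g \<le> c"
  unfolding vals_def using depth_pos by (subst Max_le_iff) auto

lemma vals_nonneg: "0 \<le> vals g"
  by (rule order_trans[OF norm_ge_zero norm_le_vals[of 0 1]]) (use depth_pos in auto)

lemma slopes_nonneg: "0 \<le> slopes g q"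
  unfolding slopes_def by (simp add: sum_nonneg)

lemma norm_le_gnorm:
  assumes "c \<in> blocks k s"
  shows "norm (g c) \<le> gnorm g"
proof -
  let ?w = "\<lambda>q. real (s+1) * b * real (depth k - q)"
  have w: "0 \<le> ?w q * slopes g q" for q
    using b_ge_1 by (intro mult_nonneg_nonneg slopes_nonneg) auto
  consider (Val) q j where "c = Val q j" "q < depth k" "j \<in> {1..s+1}"
    | (Slope) q j where "c = Slope q j" "q < depth k" "j \<in> {1..s+1}"
    using assms unfolding blocks_def by blast
  then show ?thesis
  proof cases
    case Val
    then show ?thesis
      unfolding gnorm_def using norm_le_vals[of q j g] sum_nonneg[of "{..<depth k}" "\<lambda>q. ?w q * slopes g q"] w
      by fastforce
  next
    case Slope
    have "norm (g c) \<le> slopes g q"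
      unfolding slopes_def Slope(1) by (rule member_le_sum) (use Slope in auto)
    moreover have "1 * 1 * 1 \<le> ?w q"
      by (intro mult_mono) (use b_ge_1 Slope in auto)
    from mult_right_mono[OF this slopes_nonneg[of g q]]
    have "1 * 1 * 1 * slopes g q \<le> ?w q * slopes g q" .
    moreover have "?w q * slopes g q \<le> (\<Sum>q<depth k. ?w q * slopes g q)"
      using Slope by (intro member_le_sum w) auto
    ultimately show ?thesis
      unfolding gnorm_def using vals_nonneg[of g] by linarith
  qed
qed

lemma gnorm_nonneg: "0 \<le> gnorm g"
proof -
  have "Val 0 1 \<in> blocks k s" using depth_pos by (auto simp: blocks_def)
  from norm_le_gnorm[OF this] show ?thesis using norm_ge_zero order_trans by blast
qed

lemma gnorm_triangle: "gnorm (\<lambda>c. g c + g' c) \<le> gnorm g + gnorm g'"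
proof -
  have "vals (\<lambda>c. g c + g' c) \<le> vals g + vals g'"
    by (intro vals_le) (meson norm_triangle_mono norm_le_vals)
  moreover have "slopes (\<lambda>c. g c + g' c) q \<le> slopes g q + slopes g' q" for q
    unfolding slopes_def sum.distrib[symmetric] by (intro sum_mono norm_triangle_ineq)
  then have "(\<Sum>q<depth k. real (s+1) * b * real (depth k - q) * slopes (\<lambda>c. g c + g' c) q)
    \<le> (\<Sum>q<depth k. real (s+1) * b * real (depth k - q) * (slopes g q + slopes g' q))"
    using b_ge_1 by (intro sum_mono mult_left_mono) auto
  ultimately show ?thesis
    unfolding gnorm_def by (simp add: distrib_left sum.distrib)
qed

lemma gnorm_diff_triangle: "gnorm g \<le> gnorm g' + gnorm (\<lambda>c. g c - g' c)"
  using gnorm_triangle[of g' "\<lambda>c. g c - g' c"] by simp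

lemma gnorm_minus_commute: "gnorm (\<lambda>c. g c - g' c) = gnorm (\<lambda>c. g' c - g c)"
  by (simp add: gnorm_def vals_def slopes_def norm_minus_commute)

lemma gnorm_cong: "(\<And>c. c \<in> blocks k s \<Longrightarrow> g c = g' c) \<Longrightarrow> gnorm g = gnorm g'"
proof -
  assume eq: "\<And>c. c \<in> blocks k s \<Longrightarrow> g c = g' c"
  have "vals g = vals g'"
    unfolding vals_def by (intro arg_cong[where f=Max] image_cong) (auto simp: eq blocks_def)
  moreover have "slopes g q = slopes g' q" if "q < depth k" for q
    unfolding slopes_def using that by (intro sum.cong) (auto simp: eq blocks_def)
  ultimately show ?thesis unfolding gnorm_def by auto
qed

text \<open>An infinite set has \<open>card\<close> 0, but the count of the blocks is
  positive.\<close>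

lemma finite_blocks: "finite (blocks k s)"
proof (rule ccontr)
  assume "infinite (blocks k s)"
  then show False using card_blocks[of k s] depth_pos by simp
qed

text \<open>The weight of a slope of age 0, the largest weight in \<open>gnorm\<close>.\<close>

definition wt :: real where
  "wt = real (s+1) * b * real (depth k)"

text \<open>Together with \<open>norm_le_gnorm\<close> this makes convergence in
  \<open>gnorm\<close> the same as convergence of every block.\<close>

lemma gnorm_le_sum: "gnorm g \<le> (1 + real (depth k) * (real (s+1) * wt)) * (\<Sum>c\<in>blocks k s. norm (g c))"
proof -
  let ?S = "\<Sum>c\<in>blocks k s. norm (g c)"
  have mem: "norm (g c) \<le> ?S" if "c \<in> blocks k s" for c
    using that finite_blocks by (intro member_le_sum) auto
  have S: "0 \<le> ?S" by (simp add: sum_nonneg)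
  have 1: "vals g \<le> ?S"
    by (intro vals_le mem) (auto simp: blocks_def)
  have sl: "slopes g q \<le> real (s+1) * ?S" if "q < depth k" for q
    unfolding slopes_def using sum_bounded_above[of "{1..s+1}" "\<lambda>j. norm (g (Slope q j))" ?S] mem that
    by (auto simp: blocks_def)
  have "real (s+1) * b * real (depth k - q) * slopes g q \<le> wt * (real (s+1) * ?S)" if "q < depth k" for q
    unfolding wt_def using b_ge_1 S sl[OF that] slopes_nonneg by (intro mult_mono) auto
  then have "(\<Sum>q<depth k. real (s+1) * b * real (depth k - q) * slopes g q)
      \<le> real (depth k) * (wt * (real (s+1) * ?S))"
    using sum_bounded_above[of "{..<depth k}" "\<lambda>q. real (s+1) * b * real (depth k - q) * slopes g q"] by auto
  with 1 show ?thesis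
    unfolding gnorm_def by (simp add: algebra_simps)
qed

text \<open>The ages \<open>l-2\<close> run through \<open>{..<k-1}\<close>, which lies in
  \<open>{..<depth k}\<close>; for \<open>k = 1\<close> the left side is empty while
  \<open>depth k\<close> is still 1.\<close>

lemma sum_old_le:
  assumes "\<And>q j. q < depth k \<Longrightarrow> j \<in> {1..s+1} \<Longrightarrow> 0 \<le> x q j"
  shows "(\<Sum>l=2..k. \<Sum>j=1..s. x (l-2) j) \<le> (\<Sum>q<depth k. \<Sum>j=1..s+1. (x q j :: real))"
proof -
  have "(\<Sum>l=2..k. \<Sum>j=1..s. x (l-2) j) = (\<Sum>q\<in>{..<k-1}. \<Sum>j=1..s. x q j)"
    by (rule sum.reindex_bij_witness[of _ "\<lambda>q. q + 2" "\<lambda>l. l - 2"]) auto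
  also have "\<dots> \<le> (\<Sum>q\<in>{..<k-1}. \<Sum>j=1..s+1. x q j)"
    using assms by (intro sum_mono sum_mono2) (auto simp: depth_def)
  also have "\<dots> \<le> (\<Sum>q<depth k. \<Sum>j=1..s+1. x q j)"
    using assms by (intro sum_mono2 sum_nonneg) (auto simp: depth_def)
  finally show ?thesis .
qed

section \<open>Stability of a single step\<close>

text \<open>
  The recursion of the stages with arbitrary new slopes \<open>r\<close>, so that it applies to differences of
  two runs of the method as well as to a single run.
\<close>

definition stage_eqs ::
  "(block \<Rightarrow> 'v::real_normed_vector) \<Rightarrow> (nat \<Rightarrow> 'v) \<Rightarrow> (nat \<Rightarrow> 'v) \<Rightarrow> bool" where
  "stage_eqs d e r \<longleftrightarrow> e 1 = d (Val 0 (s+1)) \<and> (\<forall>i\<in>{2..s+1}. e i =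
      (\<Sum>l=2..k. \<Sum>j=1..s. \<alpha> l i j *\<^sub>R d (Val (l-2) j) + \<beta> l i j *\<^sub>R d (Slope (l-2) j))
    + (\<Sum>j=1..<i. \<alpha> 1 i j *\<^sub>R e j + \<beta> 1 i j *\<^sub>R r j))"

text \<open>Let \<open>E\<close> bound the old values and all earlier stages. The \<alpha>-part of
  the next stage is a convex combination and stays below \<open>E\<close>; the \<beta>-part adds at
  most \<open>real s * b * \<mu> * E\<close> and a fixed increment. The bound solves this linear
  recursion over the stages.\<close>

lemma norm_stage_le:
  assumes eqs: "stage_eqs d e r"
    and slope: "\<And>j. j \<in> {1..s+1} \<Longrightarrow> norm (r j) \<le> \<mu> * norm (e j) + p"
    and "0 \<le> \<mu>" "0 \<le> p" and "i \<in> {1..s+1}"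
  shows "norm (e i) \<le> (1 + real s * b * \<mu>) ^ i * (vals d + real i * b * ((\<Sum>q<depth k. slopes d q) + real s * p))"
  using \<open>i \<in> {1..s+1}\<close>
proof (induction i rule: less_induct)
  case (less i)
  let ?Q = "1 + real s * b * \<mu>" and ?\<sigma> = "\<Sum>q<depth k. slopes d q" and ?A = "vals d"
  let ?y = "?\<sigma> + real s * p"
  let ?E = "\<lambda>i. ?Q ^ i * (?A + real i * b * ?y)"
  have \<sigma>: "0 \<le> ?\<sigma>" by (simp add: sum_nonneg slopes_nonneg)
  have y: "0 \<le> ?y" using \<sigma> assms by simp
  have Q: "1 \<le> ?Q" using assms b_ge_1 by simp
  have A: "0 \<le> ?A" by (rule vals_nonneg)
  have Epos: "0 \<le> ?A + real i * b * ?y" for i using A y b_ge_1 by simp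
  have Emono: "?E m \<le> ?E n" if "m \<le> n" for m n
  proof (intro mult_mono)
    show "?Q ^ m \<le> ?Q ^ n" using Q that by (rule power_increasing[rotated])
    show "?A + real m * b * ?y \<le> ?A + real n * b * ?y"
      using that b_ge_1 y by (intro add_left_mono mult_right_mono) auto
  qed (use Q Epos in auto)
  show ?case
  proof (cases "i = 1")
    case True
    have "norm (e 1) \<le> ?A"
      using eqs norm_le_vals[of 0 "s+1" d] depth_pos by (simp add: stage_eqs_def)
    also have "?A = ?E 0" by simp
    also have "?E 0 \<le> ?E 1" by (rule Emono) simp
    finally show ?thesis using True by simp
  next
    case False
    with less.prems have i: "i \<in> {2..s+1}" by auto
    \<comment> \<open>As \<open>?E\<close> increases with the stage, its value at \<open>i-1\<close>
      covers the old values, bounded by \<open>?E 0\<close>, and all stages below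
      \<open>i\<close>.\<close>
    define E where "E = ?E (i-1)"
    have AE: "?A \<le> E" using Emono[of 0 "i-1"] by (simp add: E_def)
    have E: "0 \<le> E" using A AE by simp
    have an: "0 \<le> \<alpha> l i j" if "l \<in> {2..k}" "j \<in> {1..s}" for l j
      using alpha_nonneg i that unfolding nonneg_coeffs_def by blast
    have an1: "0 \<le> \<alpha> 1 i j" if "j \<in> {1..<i}" for j
      using alpha_nonneg i that unfolding nonneg_coeffs_def by blast
    have old1: "norm (\<alpha> l i j *\<^sub>R d (Val (l-2) j) + \<beta> l i j *\<^sub>R d (Slope (l-2) j))
        \<le> \<alpha> l i j * E + b * norm (d (Slope (l-2) j))" if lj: "l \<in> {2..k}" "j \<in> {1..s}" for l j
    proof -
      have "norm (d (Val (l-2) j)) \<le> ?A"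
        using lj by (intro norm_le_vals) (auto simp: depth_def)
      then have "norm (\<alpha> l i j *\<^sub>R d (Val (l-2) j)) \<le> \<alpha> l i j * E"
        using an[OF lj] AE by (simp add: mult_left_mono)
      moreover have "norm (\<beta> l i j *\<^sub>R d (Slope (l-2) j)) \<le> b * norm (d (Slope (l-2) j))"
        using beta_bound[of l i j] lj i by (simp add: mult_right_mono)
      ultimately show ?thesis by (rule norm_triangle_mono)
    qed
    have "norm (\<Sum>l=2..k. \<Sum>j=1..s. \<alpha> l i j *\<^sub>R d (Val (l-2) j) + \<beta> l i j *\<^sub>R d (Slope (l-2) j))
        \<le> (\<Sum>l=2..k. \<Sum>j=1..s. \<alpha> l i j * E + b * norm (d (Slope (l-2) j)))"
      by (intro sum_norm_le old1) auto
    also have "\<dots> = (\<Sum>l=2..k. \<Sum>j=1..s. \<alpha> l i j) * E + b * (\<Sum>l=2..k. \<Sum>j=1..s. norm (d (Slope (l-2) j)))"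
      by (simp add: sum.distrib sum_distrib_left sum_distrib_right)
    also have "\<dots> \<le> (\<Sum>l=2..k. \<Sum>j=1..s. \<alpha> l i j) * E + b * ?\<sigma>"
      unfolding slopes_def using b_ge_1 by (intro add_left_mono mult_left_mono sum_old_le) auto
    finally have old: "norm (\<Sum>l=2..k. \<Sum>j=1..s. \<alpha> l i j *\<^sub>R d (Val (l-2) j) + \<beta> l i j *\<^sub>R d (Slope (l-2) j))
        \<le> (\<Sum>l=2..k. \<Sum>j=1..s. \<alpha> l i j) * E + b * ?\<sigma>" .
    have new1: "norm (\<alpha> 1 i j *\<^sub>R e j + \<beta> 1 i j *\<^sub>R r j) \<le> \<alpha> 1 i j * E + b * (\<mu> * E + p)"
      if j: "j \<in> {1..<i}" for j
    proof -
      have j': "j \<in> {1..s+1}" using j i by auto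
      have "norm (e j) \<le> ?E j" using j j' by (intro less.IH) auto
      also have "?E j \<le> E" unfolding E_def using j by (intro Emono) auto
      finally have e: "norm (e j) \<le> E" .
      have "norm (r j) \<le> \<mu> * norm (e j) + p" by (rule slope[OF j'])
      also have "\<dots> \<le> \<mu> * E + p" using e assms by (simp add: mult_left_mono)
      finally have r: "norm (r j) \<le> \<mu> * E + p" .
      have "norm (\<beta> 1 i j *\<^sub>R r j) \<le> b * (\<mu> * E + p)"
        using beta_bound[of 1 i j] i j' k_ge_1 r b_ge_1 by (simp add: mult_mono)
      moreover have "norm (\<alpha> 1 i j *\<^sub>R e j) \<le> \<alpha> 1 i j * E"
        using an1[OF j] e by (simp add: mult_left_mono)
      ultimately show ?thesis by (rule norm_triangle_mono[rotated])
    qed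
    have "norm (\<Sum>j=1..<i. \<alpha> 1 i j *\<^sub>R e j + \<beta> 1 i j *\<^sub>R r j)
        \<le> (\<Sum>j=1..<i. \<alpha> 1 i j * E + b * (\<mu> * E + p))"
      by (intro sum_norm_le new1)
    also have "\<dots> = (\<Sum>j=1..<i. \<alpha> 1 i j) * E + real (i-1) * (b * (\<mu> * E + p))"
      by (simp add: sum.distrib sum_distrib_right)
    also have "\<dots> \<le> (\<Sum>j=1..<i. \<alpha> 1 i j) * E + real s * (b * (\<mu> * E + p))"
      using i b_ge_1 assms E by (intro add_left_mono mult_right_mono) auto
    finally have new: "norm (\<Sum>j=1..<i. \<alpha> 1 i j *\<^sub>R e j + \<beta> 1 i j *\<^sub>R r j)
        \<le> (\<Sum>j=1..<i. \<alpha> 1 i j) * E + real s * (b * (\<mu> * E + p))" .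
    have ei: "e i =
        (\<Sum>l=2..k. \<Sum>j=1..s. \<alpha> l i j *\<^sub>R d (Val (l-2) j) + \<beta> l i j *\<^sub>R d (Slope (l-2) j))
      + (\<Sum>j=1..<i. \<alpha> 1 i j *\<^sub>R e j + \<beta> 1 i j *\<^sub>R r j)"
      using eqs i unfolding stage_eqs_def by blast
    have "norm (e i) \<le> ((\<Sum>l=2..k. \<Sum>j=1..s. \<alpha> l i j) * E + b * ?\<sigma>)
        + ((\<Sum>j=1..<i. \<alpha> 1 i j) * E + real s * (b * (\<mu> * E + p)))"
      unfolding ei by (rule norm_triangle_mono[OF old new])
    also have "\<dots> = ((\<Sum>l=2..k. \<Sum>j=1..s. \<alpha> l i j) + (\<Sum>j=1..<i. \<alpha> 1 i j)) * E
        + real s * b * \<mu> * E + b * ?y"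
      by (simp add: algebra_simps)
    also have "\<dots> = ?Q * E + b * ?y"
      by (simp only: row_sum[OF i]) (simp add: algebra_simps)
    \<comment> \<open>Enlarging the increment by \<open>?Q ^ i\<close> lets it merge with
      \<open>?Q * E\<close> into the closed form \<open>?E i\<close>.\<close>
    also have "\<dots> \<le> ?Q * E + ?Q ^ i * (b * ?y)"
      using mult_right_mono[of 1 "?Q ^ i" "b * ?y"] one_le_power[OF Q, of i] b_ge_1 y by simp
    also have "\<dots> = ?E i"
    proof -
      obtain m where m: "i = Suc m" using i by (cases i) auto
      show ?thesis unfolding E_def m by (simp add: algebra_simps)
    qed
    finally show ?thesis .
  qed
qed

text \<open>The rate at which \<open>\<mu>\<close> enters one step: \<open>s+1\<close> stage factors
  \<open>1 + real s * b * \<mu>\<close>, and \<open>s+1\<close> new slopes of weight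
  \<open>wt\<close>.\<close>

definition lip_const :: real where
  "lip_const = real (s+1) * (real s * b) + wt * real (s+1)"

text \<open>The defect \<open>p\<close> of the slopes enters a step twice: through the \<beta>-terms
  of the stages, and directly through the \<open>s+1\<close> new slopes of weight
  \<open>wt\<close>.\<close>

definition drift_const :: real where
  "drift_const = real (s+1) * b * real s + wt * real (s+1)"

lemma wt_pos: "0 < wt" using b_ge_1 depth_pos by (simp add: wt_def)

lemma lip_const_nonneg: "0 \<le> lip_const"
  using b_ge_1 wt_pos by (simp add: lip_const_def)

lemma drift_const_nonneg: "0 \<le> drift_const"
  using b_ge_1 wt_pos by (simp add: drift_const_def)

text \<open>
  A slope of age \<open>q\<close> enters at most \<open>depth k - q\<close> further steps; the weights in \<open>gnorm\<close> pay for
  these contributions in advance.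
\<close>

lemma gnorm_step_le:
  assumes eqs: "stage_eqs d e r"
    and slope: "\<And>j. j \<in> {1..s+1} \<Longrightarrow> norm (r j) \<le> \<mu> * norm (e j) + p"
    and \<mu>: "0 \<le> \<mu>" and p: "0 \<le> p"
    and new: "\<And>j. j \<in> {1..s+1} \<Longrightarrow> d' (Val 0 j) = e j" "\<And>j. j \<in> {1..s+1} \<Longrightarrow> d' (Slope 0 j) = r j"
      "\<And>q j. d' (Val (Suc q) j) = d (Val q j)" "\<And>q j. d' (Slope (Suc q) j) = d (Slope q j)"
  shows "gnorm d' \<le> exp (lip_const * \<mu>) * (gnorm d + drift_const * p)"
proof -
  let ?Q = "1 + real s * b * \<mu>" and ?\<sigma> = "\<Sum>q<depth k. slopes d q" and ?A = "vals d"
  let ?B = "real (s+1) * b"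
  let ?W = "\<Sum>q<depth k. ?B * real (depth k - Suc q) * slopes d q"
  define E where "E = ?Q ^ (s+1) * (?A + ?B * (?\<sigma> + real s * p))"
  have \<sigma>: "0 \<le> ?\<sigma>" by (simp add: sum_nonneg slopes_nonneg)
  have Q: "1 \<le> ?Q" using \<mu> b_ge_1 by simp
  have A: "0 \<le> ?A" by (rule vals_nonneg)
  have W: "0 \<le> ?W" using b_ge_1 by (intro sum_nonneg mult_nonneg_nonneg slopes_nonneg) auto
  have y: "0 \<le> ?B * (?\<sigma> + real s * p)" using \<sigma> p b_ge_1 by simp
  have e: "norm (e j) \<le> E" if "j \<in> {1..s+1}" for j
  proof -
    have "norm (e j) \<le> ?Q ^ j * (?A + real j * b * (?\<sigma> + real s * p))"
      using assms that by (intro norm_stage_le)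
    also have "\<dots> \<le> E"
      unfolding E_def
    proof (intro mult_mono)
      show "?Q ^ j \<le> ?Q ^ (s+1)" using Q that by (intro power_increasing) auto
      show "?A + real j * b * (?\<sigma> + real s * p) \<le> ?A + ?B * (?\<sigma> + real s * p)"
        using that b_ge_1 \<sigma> p by (intro add_left_mono mult_right_mono) auto
    qed (use Q A \<sigma> p b_ge_1 in auto)
    finally show ?thesis .
  qed
  have AE: "?A \<le> E"
    unfolding E_def using mult_mono[of 1 "?Q ^ (s+1)" ?A "?A + ?B * (?\<sigma> + real s * p)"] one_le_power[OF Q, of "s+1"] A y
    by simp
  have E: "0 \<le> E" using A AE by simp
  have v: "vals d' \<le> E"
  proof (rule vals_le)
    fix q j assume qj: "q < depth k" "j \<in> {1..s+1}"
    show "norm (d' (Val q j)) \<le> E"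
    proof (cases q)
      case 0
      then show ?thesis using new(1) e qj by simp
    next
      case (Suc q')
      then show ?thesis using new(3) norm_le_vals[of q' j d] qj AE by simp
    qed
  qed
  have s0: "slopes d' 0 \<le> real (s+1) * (\<mu> * E + p)"
  proof -
    have "norm (d' (Slope 0 j)) \<le> \<mu> * E + p" if "j \<in> {1..s+1}" for j
    proof -
      have "norm (d' (Slope 0 j)) \<le> \<mu> * norm (e j) + p" using new(2) slope that by simp
      also have "\<dots> \<le> \<mu> * E + p" using e[OF that] \<mu> by (simp add: mult_left_mono)
      finally show ?thesis .
    qed
    then show ?thesis
      unfolding slopes_def using sum_bounded_above[of "{1..s+1}" "\<lambda>j. norm (d' (Slope 0 j))"] by simp
  qed
  obtain m where m: "depth k = Suc m" using depth_pos by (cases "depth k") auto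
  have "(\<Sum>q<depth k. ?B * real (depth k - q) * slopes d' q)
     = wt * slopes d' 0 + (\<Sum>q<m. ?B * real (depth k - Suc q) * slopes d q)"
    unfolding m sum.lessThan_Suc_shift wt_def by (simp add: slopes_def new)
  \<comment> \<open>The additional summand \<open>q = m\<close> of \<open>?W\<close> has weight 0:
    the oldest slope drops out of the vector.\<close>
  also have "(\<Sum>q<m. ?B * real (depth k - Suc q) * slopes d q) = ?W"
    unfolding m by simp
  finally have sum': "(\<Sum>q<depth k. ?B * real (depth k - q) * slopes d' q) = wt * slopes d' 0 + ?W" .
  \<comment> \<open>Lowering every weight by one unit releases \<open>?B * ?\<sigma>\<close>, which
    is exactly the slope term in \<open>E\<close>.\<close>
  have sum: "(\<Sum>q<depth k. ?B * real (depth k - q) * slopes d q) = ?B * ?\<sigma> + ?W"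
    unfolding sum_distrib_left sum.distrib[symmetric]
  proof (intro sum.cong refl)
    fix q assume "q \<in> {..<depth k}"
    then have "real (depth k - q) = 1 + real (depth k - Suc q)" by auto
    then show "?B * real (depth k - q) * slopes d q
        = ?B * slopes d q + ?B * real (depth k - Suc q) * slopes d q"
      by (simp only:) (simp add: algebra_simps)
  qed
  define G where "G = ?Q ^ (s+1)"
  define F where "F = G * (1 + wt * real (s+1) * \<mu>)"
  have F: "1 \<le> F"
    unfolding F_def G_def
    using mult_mono[of 1 "?Q ^ (s+1)" 1 "1 + wt * real (s+1) * \<mu>"] one_le_power[OF Q, of "s+1"] wt_pos \<mu>
    by simp
  have P: "0 \<le> wt * real (s+1) * p" using p wt_pos by simp
  have "gnorm d' \<le> E + wt * (real (s+1) * (\<mu> * E + p)) + ?W"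
    unfolding gnorm_def sum' using mult_left_mono[OF s0, of wt] wt_pos v by linarith
  also have "\<dots> = F * (?A + ?B * (?\<sigma> + real s * p)) + wt * real (s+1) * p + ?W"
    unfolding E_def F_def G_def[symmetric] by (simp add: algebra_simps)
  also have "\<dots> \<le> F * (?A + ?B * (?\<sigma> + real s * p)) + F * (wt * real (s+1) * p) + F * ?W"
    using mult_right_mono[OF F W] mult_right_mono[OF F P] by linarith
  also have "\<dots> = F * (gnorm d + drift_const * p)"
    unfolding gnorm_def sum drift_const_def by (simp add: distrib_left distrib_right mult_ac)
  also have "\<dots> \<le> exp (lip_const * \<mu>) * (gnorm d + drift_const * p)"
  proof (rule mult_right_mono)
    \<comment> \<open>Both kinds of factors are of the form \<open>1 + x\<close>, which is at most
      \<open>exp x\<close>.\<close>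
    have "F \<le> exp (real s * b * \<mu>) ^ (s+1) * exp (wt * real (s+1) * \<mu>)"
      unfolding F_def G_def using exp_ge_add_one_self Q wt_pos \<mu> by (intro mult_mono power_mono) auto
    also have "\<dots> = exp (lip_const * \<mu>)"
      unfolding exp_of_nat_mult[symmetric] exp_add[symmetric] lip_const_def by (simp add: algebra_simps)
    finally show "F \<le> exp (lip_const * \<mu>)" .
    show "0 \<le> gnorm d + drift_const * p"
      by (intro add_nonneg_nonneg mult_nonneg_nonneg gnorm_nonneg drift_const_nonneg p)
  qed
  finally show ?thesis .
qed

section \<open>Comparison of two runs\<close>

lemma gl_stage_rec:
  assumes "\<not> i \<le> 1"
  shows "gl_stage \<alpha> \<beta> k s \<tau> f g i =
      (\<Sum>l=2..k. \<Sum>j=1..s. \<alpha> l i j *\<^sub>R g (Val (l-2) j) + \<beta> l i j *\<^sub>R g (Slope (l-2) j))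
    + (\<Sum>j=1..<i. \<alpha> 1 i j *\<^sub>R gl_stage \<alpha> \<beta> k s \<tau> f g j
         + \<beta> 1 i j *\<^sub>R (\<tau> *\<^sub>R f (gl_stage \<alpha> \<beta> k s \<tau> f g j)))"
  using assms by (subst gl_stage.simps) (simp only: if_False)

text \<open>The stages are linear in the input vector and the new slopes, so the right-hand sides
  and factors of the two runs may differ. Comparison with the zero run covers a single run.\<close>

lemma stage_eqs_diff:
  "stage_eqs (\<lambda>c. g c - g' c) (\<lambda>i. gl_stage \<alpha> \<beta> k s \<tau> f g i - gl_stage \<alpha> \<beta> k s \<tau>' f' g' i)
     (\<lambda>i. \<tau> *\<^sub>R f (gl_stage \<alpha> \<beta> k s \<tau> f g i) - \<tau>' *\<^sub>R f' (gl_stage \<alpha> \<beta> k s \<tau>' f' g' i))"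
  unfolding stage_eqs_def
proof (intro conjI ballI)
  show "gl_stage \<alpha> \<beta> k s \<tau> f g 1 - gl_stage \<alpha> \<beta> k s \<tau>' f' g' 1 = g (Val 0 (s+1)) - g' (Val 0 (s+1))"
    by (simp add: gl_stage.simps)
next
  fix i assume "i \<in> {2..s+1}"
  then have i: "\<not> i \<le> 1" by auto
  show "gl_stage \<alpha> \<beta> k s \<tau> f g i - gl_stage \<alpha> \<beta> k s \<tau>' f' g' i =
      (\<Sum>l=2..k. \<Sum>j=1..s. \<alpha> l i j *\<^sub>R (g (Val (l-2) j) - g' (Val (l-2) j))
         + \<beta> l i j *\<^sub>R (g (Slope (l-2) j) - g' (Slope (l-2) j)))
    + (\<Sum>j=1..<i. \<alpha> 1 i j *\<^sub>R (gl_stage \<alpha> \<beta> k s \<tau> f g j - gl_stage \<alpha> \<beta> k s \<tau>' f' g' j)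
         + \<beta> 1 i j *\<^sub>R (\<tau> *\<^sub>R f (gl_stage \<alpha> \<beta> k s \<tau> f g j) - \<tau>' *\<^sub>R f' (gl_stage \<alpha> \<beta> k s \<tau>' f' g' j)))"
    unfolding gl_stage_rec[OF i] by (simp add: sum_subtractf sum.distrib scaleR_diff_right)
qed

text \<open>A discrete Gronwall estimate: in each step the Lipschitz constant gives growth at rate
  \<open>\<tau> * L\<close>, and the difference of the factors gives a defect of at most
  \<open>K * \<bar>\<tau> - \<tau>'\<bar>\<close>.\<close>

lemma gnorm_iter_diff:
  fixes f :: "'v::real_normed_vector \<Rightarrow> 'v"
  assumes lip: "\<And>y z. norm (f y - f z) \<le> L * norm (y - z)" and bd: "\<And>z. norm (f z) \<le> K"
    and L: "0 \<le> L" and \<tau>: "0 \<le> \<tau>"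
  shows "gnorm (\<lambda>c. (gl_step \<alpha> \<beta> k s \<tau> f ^^ n) g c - (gl_step \<alpha> \<beta> k s \<tau>' f ^^ n) g' c)
    \<le> exp (lip_const * L * (real n * \<tau>)) * (gnorm (\<lambda>c. g c - g' c) + drift_const * K * (real n * \<bar>\<tau> - \<tau>'\<bar>))"
proof (induction n)
  case 0
  show ?case by simp
next
  case (Suc n)
  let ?g = "(gl_step \<alpha> \<beta> k s \<tau> f ^^ n) g" and ?g' = "(gl_step \<alpha> \<beta> k s \<tau>' f ^^ n) g'"
  let ?Y = "gl_stage \<alpha> \<beta> k s \<tau> f ?g" and ?Y' = "gl_stage \<alpha> \<beta> k s \<tau>' f ?g'"
  let ?a = "lip_const * L * \<tau>" and ?p = "K * \<bar>\<tau> - \<tau>'\<bar>"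
  let ?D = "gnorm (\<lambda>c. g c - g' c)"
  have K: "0 \<le> K" using bd norm_ge_zero order_trans by blast
  have a: "0 \<le> ?a" using lip_const_nonneg L \<tau> by simp
  have "gnorm (\<lambda>c. gl_step \<alpha> \<beta> k s \<tau> f ?g c - gl_step \<alpha> \<beta> k s \<tau>' f ?g' c)
     \<le> exp (lip_const * (\<tau> * L)) * (gnorm (\<lambda>c. ?g c - ?g' c) + drift_const * ?p)"
  proof (rule gnorm_step_le[OF stage_eqs_diff[of _ _ \<tau> f \<tau>' f]])
    fix j
    have eq: "\<tau> *\<^sub>R f (?Y j) - \<tau>' *\<^sub>R f (?Y' j) = \<tau> *\<^sub>R (f (?Y j) - f (?Y' j)) + (\<tau> - \<tau>') *\<^sub>R f (?Y' j)"
      by (simp add: algebra_simps)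
    have "norm (\<tau> *\<^sub>R f (?Y j) - \<tau>' *\<^sub>R f (?Y' j)) \<le> \<tau> * (L * norm (?Y j - ?Y' j)) + \<bar>\<tau> - \<tau>'\<bar> * K"
      unfolding eq using lip bd \<tau> by (intro norm_triangle_mono) (auto intro: mult_left_mono)
    then show "norm (\<tau> *\<^sub>R f (?Y j) - \<tau>' *\<^sub>R f (?Y' j)) \<le> \<tau> * L * norm (?Y j - ?Y' j) + ?p"
      by (simp only: mult_ac)
  qed (use K L \<tau> in auto)
  also have "\<dots> \<le> exp ?a * (exp (real n * ?a) * (?D + drift_const * (real n * ?p)) + exp (real n * ?a) * (drift_const * ?p))"
  proof -
    \<comment> \<open>The new defect is enlarged by the accumulated growth, so that all defects
      share one exponential factor.\<close>
    have "1 * (drift_const * ?p) \<le> exp (real n * ?a) * (drift_const * ?p)"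
      using a K drift_const_nonneg by (intro mult_right_mono) auto
    with Suc show ?thesis by (simp add: mult_ac)
  qed
  also have "\<dots> = exp (?a + real n * ?a) * (?D + drift_const * (real (Suc n) * ?p))"
    by (simp add: exp_add algebra_simps)
  finally show ?case
    by (simp add: algebra_simps)
qed

text \<open>Here the slopes count entirely as defect, with \<open>\<mu> = 0\<close>. The growth
  factor is then 1 and the norm increases at most linearly in time, which suits short
  slices.\<close>

lemma gnorm_iter_le:
  fixes f :: "'v::real_normed_vector \<Rightarrow> 'v"
  assumes bd: "\<And>z. norm (f z) \<le> K" and \<tau>: "0 \<le> \<tau>"
  shows "gnorm ((gl_step \<alpha> \<beta> k s \<tau> f ^^ n) g) \<le> gnorm g + drift_const * K * (real n * \<tau>)"
proof (induction n)
  case 0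
  show ?case by simp
next
  case (Suc n)
  let ?g = "(gl_step \<alpha> \<beta> k s \<tau> f ^^ n) g"
  have K: "0 \<le> K" using bd norm_ge_zero order_trans by blast
  have zero: "gl_stage \<alpha> \<beta> k s 0 (\<lambda>_. 0) (\<lambda>_. 0) i = 0" for i
    by (induction i rule: less_induct) (subst gl_stage.simps, simp)
  have "gnorm (gl_step \<alpha> \<beta> k s \<tau> f ?g) \<le> exp (lip_const * 0) * (gnorm (\<lambda>c. ?g c - 0) + drift_const * (\<tau> * K))"
    by (rule gnorm_step_le[OF stage_eqs_diff[of _ _ \<tau> f 0 "\<lambda>_. 0"]])
      (use bd \<tau> K in \<open>auto simp: zero intro: mult_left_mono\<close>)
  with Suc show ?case by (simp add: algebra_simps)
qed

section \<open>Modified right-hand sides and bounds on whole runs\<close>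

lemma gl_stage_cong:
  assumes g: "\<And>c. c \<in> blocks k s \<Longrightarrow> g c = g' c"
    and f: "\<And>j. j \<in> {1..s+1} \<Longrightarrow> f (gl_stage \<alpha> \<beta> k s \<tau> f g j) = f' (gl_stage \<alpha> \<beta> k s \<tau> f g j)"
    and "i \<in> {1..s+1}"
  shows "gl_stage \<alpha> \<beta> k s \<tau> f' g' i = gl_stage \<alpha> \<beta> k s \<tau> f g i"
  using \<open>i \<in> {1..s+1}\<close>
proof (induction i rule: less_induct)
  case (less i)
  have top: "g (Val 0 (s+1)) = g' (Val 0 (s+1))"
    using depth_pos by (intro g) (auto simp: blocks_def)
  have old: "g (Val (l-2) j) = g' (Val (l-2) j)" "g (Slope (l-2) j) = g' (Slope (l-2) j)"
    if "l \<in> {2..k}" "j \<in> {1..s}" for l j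
    using that by (auto intro!: g simp: blocks_def depth_def)
  have new: "gl_stage \<alpha> \<beta> k s \<tau> f' g' j = gl_stage \<alpha> \<beta> k s \<tau> f g j"
      "f' (gl_stage \<alpha> \<beta> k s \<tau> f g j) = f (gl_stage \<alpha> \<beta> k s \<tau> f g j)" if "j \<in> {1..<i}" for j
  proof -
    show "gl_stage \<alpha> \<beta> k s \<tau> f' g' j = gl_stage \<alpha> \<beta> k s \<tau> f g j"
      using that less.prems by (intro less.IH) auto
    show "f' (gl_stage \<alpha> \<beta> k s \<tau> f g j) = f (gl_stage \<alpha> \<beta> k s \<tau> f g j)"
      using that less.prems by (intro f[symmetric]) auto
  qed
  show ?case
  proof (cases "i \<le> 1")
    case True
    then show ?thesis using top by (simp add: gl_stage.simps)
  next
    case False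
    then show ?thesis
      unfolding gl_stage_rec[OF False] by (intro arg_cong2[where f="(+)"] sum.cong refl) (simp_all only: old new)
  qed
qed

text \<open>A bound on the run with \<open>f\<close> alone suffices: the run with \<open>f'\<close>
  is then shown to follow it step by step.\<close>

lemma gl_iter_cong:
  fixes f f' :: "'v::real_normed_vector \<Rightarrow> 'v"
  assumes eq: "\<And>z. norm z \<le> R \<Longrightarrow> f z = f' z"
    and bd: "\<And>m. m \<le> n \<Longrightarrow> gnorm ((gl_step \<alpha> \<beta> k s \<tau> f ^^ m) g) \<le> R"
    and "c \<in> blocks k s"
  shows "(gl_step \<alpha> \<beta> k s \<tau> f' ^^ n) g c = (gl_step \<alpha> \<beta> k s \<tau> f ^^ n) g c"
  using bd \<open>c \<in> blocks k s\<close>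
proof (induction n arbitrary: c)
  case 0
  show ?case by simp
next
  case (Suc n)
  let ?g = "(gl_step \<alpha> \<beta> k s \<tau> f ^^ n) g" and ?g' = "(gl_step \<alpha> \<beta> k s \<tau> f' ^^ n) g"
  have IH: "?g c = ?g' c" if "c \<in> blocks k s" for c
    using Suc.IH[OF _ that] Suc.prems(1) by simp
  have f: "f (gl_stage \<alpha> \<beta> k s \<tau> f ?g j) = f' (gl_stage \<alpha> \<beta> k s \<tau> f ?g j)" if "j \<in> {1..s+1}" for j
  proof (rule eq)
    \<comment> \<open>The stages of this step are blocks of the next vector, so the bound after
      \<open>Suc n\<close> steps controls the arguments of \<open>f\<close>.\<close>
    have "Val 0 j \<in> blocks k s" using that depth_pos by (auto simp: blocks_def)
    from norm_le_gnorm[OF this, of "(gl_step \<alpha> \<beta> k s \<tau> f ^^ Suc n) g"] Suc.prems(1)[of "Suc n"]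
    show "norm (gl_stage \<alpha> \<beta> k s \<tau> f ?g j) \<le> R" by simp
  qed
  have stage: "gl_stage \<alpha> \<beta> k s \<tau> f' ?g' j = gl_stage \<alpha> \<beta> k s \<tau> f ?g j" if "j \<in> {1..s+1}" for j
    using IH f that by (rule gl_stage_cong)
  obtain q j where c: "c = Val q j \<or> c = Slope q j" and q: "q < depth k" and j: "j \<in> {1..s+1}"
    using Suc.prems(2) unfolding blocks_def by blast
  show ?case
  proof (cases q)
    case 0
    then show ?thesis using c j f stage by auto
  next
    case (Suc q')
    then have "Val q' j \<in> blocks k s" "Slope q' j \<in> blocks k s" using q j by (auto simp: blocks_def)
    then show ?thesis using c IH Suc by auto
  qed
qed

text \<open>Sharpens an a priori bound \<open>R\<close> to \<open>R1 + 1\<close>. The bound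
  \<open>R\<close> allows \<open>f\<close> to be replaced by \<open>f'\<close>, for which runs with
  equally many steps vary equicontinuously with the end point. Convergence on a finite net of end
  points then controls all runs with many steps; runs with few steps hardly move as \<open>h\<close>
  tends to 0.\<close>

lemma gnorm_uniform_bound:
  fixes f f' :: "'v::real_normed_vector \<Rightarrow> 'v"
  assumes eq: "\<And>z. norm z \<le> R \<Longrightarrow> f' z = f z"
    and lip: "\<And>y z. norm (f' y - f' z) \<le> L * norm (y - z)" and bd: "\<And>z. norm (f' z) \<le> K"
    and L: "0 \<le> L" and d: "0 < d"
    and \<theta>: "\<forall>\<^sub>F h in at_right 0. 0 \<le> \<theta> h \<and> \<theta> h \<le> 2 * h \<and> \<bar>\<theta> h - h\<bar> \<le> C * h\<^sup>2" and C: "0 \<le> C"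
    and Z: "\<And>a. 0 \<le> a \<Longrightarrow> a \<le> d \<Longrightarrow> gnorm (Z a) \<le> R1"
    and \<psi>: "((\<lambda>h. gnorm (\<lambda>c. \<psi> h c - Z 0 c)) \<longlongrightarrow> 0) (at_right 0)"
    and conv: "\<And>a. 0 < a \<Longrightarrow> a \<le> d \<Longrightarrow>
        (\<lambda>n. gnorm (\<lambda>c. (gl_step \<alpha> \<beta> k s (\<theta> (a / real n)) f ^^ n) (\<psi> (a / real n)) c - Z a c)) \<longlonglongrightarrow> 0"
    and R: "\<forall>\<^sub>F h in at_right 0. \<forall>m. real m * h \<le> d \<longrightarrow> gnorm ((gl_step \<alpha> \<beta> k s (\<theta> h) f' ^^ m) (\<psi> h)) \<le> R"
  shows "\<forall>\<^sub>F h in at_right 0. \<forall>m. real m * h \<le> d \<longrightarrow> gnorm ((gl_step \<alpha> \<beta> k s (\<theta> h) f' ^^ m) (\<psi> h)) \<le> R1 + 1"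
proof -
  define w where "w h m = (gl_step \<alpha> \<beta> k s (\<theta> h) f' ^^ m) (\<psi> h)" for h m
  define E where "E = exp (lip_const * L * (2 * d))"
  define Cd where "Cd = drift_const * K"
  have K: "0 \<le> K" using bd norm_ge_zero order_trans by blast
  have E: "1 \<le> E" using lip_const_nonneg L d by (simp add: E_def)
  have Cd: "0 \<le> Cd" using drift_const_nonneg K by (simp add: Cd_def)
  have conv': "(\<lambda>n. gnorm (\<lambda>c. w (a / real n) n c - Z a c)) \<longlonglongrightarrow> 0" if a: "0 < a" "a \<le> d" for a
  proof -
    have lim: "filterlim (\<lambda>n. a / real n) (at_right 0) sequentially"
      using a by (intro stepsize_at_right)
    have "\<forall>\<^sub>F n in sequentially. gnorm (\<lambda>c. (gl_step \<alpha> \<beta> k s (\<theta> (a / real n)) f ^^ n) (\<psi> (a / real n)) c - Z a c)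
        = gnorm (\<lambda>c. w (a / real n) n c - Z a c)"
      using eventually_compose_filterlim[OF R lim] eventually_gt_at_top[of 0]
    proof eventually_elim
      case (elim n)
      have "gnorm ((gl_step \<alpha> \<beta> k s (\<theta> (a / real n)) f' ^^ m) (\<psi> (a / real n))) \<le> R" if "m \<le> n" for m
      proof -
        have "real m * (a / real n) \<le> real n * (a / real n)"
          using that a by (intro mult_right_mono) auto
        also have "\<dots> \<le> d" using a elim by simp
        finally show ?thesis using elim by blast
      qed
      then show ?case
        unfolding w_def by (intro gnorm_cong arg_cong2[where f="(-)"] refl gl_iter_cong[where R=R] eq) auto
    qed
    then show ?thesis by (rule Lim_transform_eventually[OF conv[OF a]])
  qed
  \<comment> \<open>Moving the end point by \<open>\<eta>\<close> changes the run by at most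
    \<open>E * Cd * \<eta>\<close>, here at most 1/8.\<close>
  define \<eta> where "\<eta> = 1 / (8 * (E * Cd + 1))"
  have ECd: "0 \<le> E * Cd" using E Cd by simp
  have \<eta>: "0 < \<eta>" "E * Cd * \<eta> \<le> 1 / 8"
    using ECd by (auto simp: \<eta>_def field_simps)
  obtain A where A: "A \<subseteq> {0<..d}" "finite A" "{0..d} \<subseteq> (\<Union>a\<in>A. ball a \<eta>)"
  proof (rule compactE_image[of "{0..d}" "{0<..d}" "\<lambda>a. ball a \<eta>"])
    show "{0..d} \<subseteq> (\<Union>a\<in>{0<..d}. ball a \<eta>)"
    proof
      fix a assume a: "a \<in> {0..d}"
      show "a \<in> (\<Union>a\<in>{0<..d}. ball a \<eta>)"
      proof (cases "a = 0")
        case True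
        \<comment> \<open>Convergence is available only at positive end points, so 0 is covered from
          a point close to it.\<close>
        then show ?thesis using d \<eta> by (intro UN_I[of "min d (\<eta> / 2)"]) (auto simp: dist_real_def)
      next
        case False
        then show ?thesis using a \<eta> by (intro UN_I[of a]) auto
      qed
    qed
  qed auto
  \<comment> \<open>Two starting vectors then differ by at most \<open>1 / (4 * E)\<close>, which
    the run amplifies to at most 1/4.\<close>
  have "\<forall>\<^sub>F h in at_right 0. gnorm (\<lambda>c. \<psi> h c - Z 0 c) < 1 / (8 * E)"
    using \<psi> by (rule order_tendstoD) (use E in simp)
  from eventually_conj[OF \<theta> this]
  obtain h3 where h3: "0 < h3"
    and \<theta>3: "\<And>h. 0 < h \<Longrightarrow> h < h3 \<Longrightarrow> 0 \<le> \<theta> h \<and> \<theta> h \<le> 2 * h \<and> \<bar>\<theta> h - h\<bar> \<le> C * h\<^sup>2"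
    and \<psi>3: "\<And>h. 0 < h \<Longrightarrow> h < h3 \<Longrightarrow> gnorm (\<lambda>c. \<psi> h c - Z 0 c) < 1 / (8 * E)"
    unfolding eventually_at_right_field by auto
  have "\<forall>\<^sub>F n in sequentially. \<forall>a\<in>A. gnorm (\<lambda>c. w (a / real n) n c - Z a c) < 1 / 4"
    using A by (intro eventually_ball_finite ballI order_tendstoD[OF conv']) auto
  moreover have "\<forall>\<^sub>F n in sequentially. d / real n < h3"
    using h3 by (rule order_tendstoD(2)[OF lim_const_over_n])
  moreover have "(\<lambda>n. E * Cd * (2 * C * d\<^sup>2) / real n) \<longlonglongrightarrow> 0"
    by (rule lim_const_over_n)
  then have "\<forall>\<^sub>F n in sequentially. E * Cd * (2 * C * d\<^sup>2) / real n < 1 / 8"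
    by (rule order_tendstoD) simp
  ultimately have "\<forall>\<^sub>F n in sequentially. 1 \<le> n \<and> (\<forall>a\<in>A. gnorm (\<lambda>c. w (a / real n) n c - Z a c) < 1 / 4)
      \<and> d / real n < h3 \<and> E * Cd * (2 * C * d\<^sup>2) / real n < 1 / 8"
    using eventually_ge_at_top[of "1::nat"] by eventually_elim blast
  then obtain n0 where n0: "\<And>n. n0 \<le> n \<Longrightarrow> 1 \<le> n \<and> (\<forall>a\<in>A. gnorm (\<lambda>c. w (a / real n) n c - Z a c) < 1 / 4)
      \<and> d / real n < h3 \<and> E * Cd * (2 * C * d\<^sup>2) / real n < 1 / 8"
    unfolding eventually_sequentially by blast
  \<comment> \<open>Replacing \<open>a\<close> by the net point \<open>z\<close> costs at most 1/2,
    from the starting vectors and the factors; the convergence error at \<open>z\<close> costs at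
    most 1/4.\<close>
  have late: "gnorm (w (a / real n) n) \<le> R1 + 1" if n: "n0 \<le> n" and a: "0 < a" "a \<le> d" for a n
  proof -
    have n1: "1 \<le> n" and dn: "d / real n < h3" and Cn: "E * Cd * (2 * C * d\<^sup>2) / real n < 1 / 8"
      using n0[OF n] by auto
    obtain z where z: "z \<in> A" "\<bar>a - z\<bar> < \<eta>"
    proof -
      have "a \<in> {0..d}" using a by simp
      with A(3) obtain z where "z \<in> A" "a \<in> ball z \<eta>" by blast
      with that show thesis by (simp add: dist_real_def abs_minus_commute)
    qed
    have z': "0 < z" "z \<le> d" using z A by auto
    have small: "0 < y / real n" "y / real n < h3" if "0 < y" "y \<le> d" for y
      using that n1 dn by (auto intro: le_less_trans[OF divide_right_mono])
    let ?h = "a / real n" and ?h' = "z / real n"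
    note ha = small[OF a] and hz = small[OF z']
    have n\<theta>: "real n * \<bar>\<theta> (y / real n) - y / real n\<bar> \<le> C * d\<^sup>2 / real n" if "0 < y" "y \<le> d" for y
    proof -
      have "real n * \<bar>\<theta> (y / real n) - y / real n\<bar> \<le> real n * (C * (y / real n)\<^sup>2)"
        using \<theta>3[OF small[OF that]] by (intro mult_left_mono) auto
      also have "\<dots> = C * y\<^sup>2 / real n" using n1 by (simp add: field_simps power2_eq_square)
      also have "\<dots> \<le> C * d\<^sup>2 / real n"
        using that C by (intro divide_right_mono mult_left_mono power_mono) auto
      finally show ?thesis .
    qed
    \<comment> \<open>The factors differ from the stepsizes by a total of order
      \<open>1 / real n\<close>; the stepsizes contribute the distance of the end points.\<close>
    have "real n * \<bar>\<theta> ?h - \<theta> ?h'\<bar> \<le> real n * (\<bar>\<theta> ?h - ?h\<bar> + \<bar>\<theta> ?h' - ?h'\<bar> + \<bar>?h - ?h'\<bar>)"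
      by (intro mult_left_mono) auto
    also have "\<dots> = real n * \<bar>\<theta> ?h - ?h\<bar> + real n * \<bar>\<theta> ?h' - ?h'\<bar> + \<bar>real n * (?h - ?h')\<bar>"
      by (simp add: distrib_left abs_mult)
    also have "real n * (?h - ?h') = a - z" using n1 by (simp add: field_simps)
    also have "real n * \<bar>\<theta> ?h - ?h\<bar> + real n * \<bar>\<theta> ?h' - ?h'\<bar> + \<bar>a - z\<bar> \<le> 2 * C * d\<^sup>2 / real n + \<eta>"
    proof -
      have "2 * C * d\<^sup>2 / real n = C * d\<^sup>2 / real n + C * d\<^sup>2 / real n" by simp
      with n\<theta>[OF a] n\<theta>[OF z'] z(2) show ?thesis by linarith
    qed
    finally have "E * Cd * (real n * \<bar>\<theta> ?h - \<theta> ?h'\<bar>) \<le> E * Cd * (2 * C * d\<^sup>2 / real n + \<eta>)"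
      using ECd by (rule mult_left_mono)
    also have "\<dots> = E * Cd * (2 * C * d\<^sup>2) / real n + E * Cd * \<eta>"
      by (simp add: distrib_left)
    finally have step: "E * Cd * (real n * \<bar>\<theta> ?h - \<theta> ?h'\<bar>) \<le> 1 / 4"
      using Cn \<eta> by linarith
    have "gnorm (\<lambda>c. \<psi> ?h c - \<psi> ?h' c) \<le> 1 / (8 * E) + 1 / (8 * E)"
      using gnorm_triangle[of "\<lambda>c. \<psi> ?h c - Z 0 c" "\<lambda>c. Z 0 c - \<psi> ?h' c"]
        \<psi>3[OF ha] \<psi>3[OF hz] gnorm_minus_commute[of "\<psi> ?h'" "Z 0"] by simp
    then have "E * gnorm (\<lambda>c. \<psi> ?h c - \<psi> ?h' c) \<le> E * (1 / (8 * E) + 1 / (8 * E))"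
      using E by (intro mult_left_mono) auto
    also have "\<dots> = 1 / 4" using E by (simp add: field_simps)
    finally have start: "E * gnorm (\<lambda>c. \<psi> ?h c - \<psi> ?h' c) \<le> 1 / 4" .
    have "real n * \<theta> ?h \<le> real n * (2 * ?h)"
      using \<theta>3[OF ha] by (intro mult_left_mono) auto
    also have "\<dots> \<le> 2 * d" using n1 a by simp
    finally have "exp (lip_const * L * (real n * \<theta> ?h)) \<le> E"
      unfolding E_def using lip_const_nonneg L by (simp add: mult_left_mono)
    moreover have "0 \<le> gnorm (\<lambda>c. \<psi> ?h c - \<psi> ?h' c) + Cd * (real n * \<bar>\<theta> ?h - \<theta> ?h'\<bar>)"
      using Cd by (intro add_nonneg_nonneg gnorm_nonneg) auto
    moreover have "gnorm (\<lambda>c. w ?h n c - w ?h' n c) \<le> exp (lip_const * L * (real n * \<theta> ?h))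
        * (gnorm (\<lambda>c. \<psi> ?h c - \<psi> ?h' c) + Cd * (real n * \<bar>\<theta> ?h - \<theta> ?h'\<bar>))"
      unfolding w_def Cd_def using \<theta>3[OF ha] by (intro gnorm_iter_diff lip bd L) auto
    ultimately have "gnorm (\<lambda>c. w ?h n c - w ?h' n c)
        \<le> E * (gnorm (\<lambda>c. \<psi> ?h c - \<psi> ?h' c) + Cd * (real n * \<bar>\<theta> ?h - \<theta> ?h'\<bar>))"
      by (meson mult_right_mono order_trans)
    also have "\<dots> \<le> 1 / 2"
      using start step by (simp add: distrib_left mult.assoc)
    finally have "gnorm (w ?h n) \<le> gnorm (w ?h' n) + 1 / 2"
      using gnorm_diff_triangle[of "w ?h n" "w ?h' n"] by simp
    moreover have "gnorm (w ?h' n) \<le> gnorm (Z z) + 1 / 4"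
      using gnorm_diff_triangle[of "w ?h' n" "Z z"] n0[OF n] z by fastforce
    ultimately show ?thesis using Z[of z] z' by simp
  qed
  have "((\<lambda>h. Cd * (real n0 * (2 * h))) \<longlongrightarrow> Cd * (real n0 * (2 * 0))) (at_right 0)"
    by (intro tendsto_intros)
  then have "\<forall>\<^sub>F h in at_right 0. Cd * (real n0 * (2 * h)) < 1 / 2"
    by (rule order_tendstoD) simp
  moreover have "\<forall>\<^sub>F h in at_right 0. 0 < h \<and> h < h3"
    using h3 by (rule eventually_at_right_0_less)
  ultimately show ?thesis
  proof eventually_elim
    case (elim h)
    show ?case
    proof (intro allI impI)
      fix m assume m: "real m * h \<le> d"
      have "gnorm (w h m) \<le> R1 + 1"
      proof (cases "n0 \<le> m")
        case True
        then have "0 < m" using n0 by force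
        \<comment> \<open>A run of \<open>m\<close> steps of size \<open>h\<close> is the
          \<open>m\<close>-step run to the end point \<open>real m * h\<close>.\<close>
        then show ?thesis using late[OF True, of "real m * h"] elim m by simp
      next
        case False
        have "gnorm (w h m) \<le> gnorm (\<psi> h) + Cd * (real m * \<theta> h)"
          unfolding w_def Cd_def using \<theta>3 elim by (intro gnorm_iter_le bd) auto
        also have "Cd * (real m * \<theta> h) \<le> Cd * (real n0 * (2 * h))"
          using False Cd \<theta>3[of h] elim by (intro mult_left_mono mult_mono) auto
        also have "gnorm (\<psi> h) \<le> R1 + 1 / (8 * E)"
          using gnorm_diff_triangle[of "\<psi> h" "Z 0"] Z[of 0] d \<psi>3[of h] elim by auto
        also have "1 / (8 * E) \<le> 1 / 8" using E by (simp add: field_simps)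
        finally show ?thesis using elim by simp
      qed
      then show "gnorm ((gl_step \<alpha> \<beta> k s (\<theta> h) f' ^^ m) (\<psi> h)) \<le> R1 + 1"
        by (simp add: w_def)
    qed
  qed
qed

text \<open>
  Pointwise convergence says nothing about the intermediate vectors, where a merely locally
  Lipschitz right-hand side could be large.  They are bounded one time slice after another: over a
  short slice the drift is small, so the run still agrees with the original one, and then
  the previous lemma restores the bound.
\<close>

lemma gnorm_run_bound:
  fixes f f' :: "'v::real_normed_vector \<Rightarrow> 'v"
  assumes eq: "\<And>z. norm z \<le> R1 + 2 \<Longrightarrow> f' z = f z"
    and lip: "\<And>y z. norm (f' y - f' z) \<le> L * norm (y - z)" and bd: "\<And>z. norm (f' z) \<le> K"
    and L: "0 \<le> L" and D: "0 < D"
    and \<theta>: "\<forall>\<^sub>F h in at_right 0. 0 \<le> \<theta> h \<and> \<theta> h \<le> 2 * h \<and> \<bar>\<theta> h - h\<bar> \<le> C * h\<^sup>2" and C: "0 \<le> C"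
    and Z: "\<And>a. 0 \<le> a \<Longrightarrow> a \<le> D \<Longrightarrow> gnorm (Z a) \<le> R1"
    and \<psi>: "((\<lambda>h. gnorm (\<lambda>c. \<psi> h c - Z 0 c)) \<longlongrightarrow> 0) (at_right 0)"
    and conv: "\<And>a. 0 < a \<Longrightarrow> a \<le> D \<Longrightarrow>
        (\<lambda>n. gnorm (\<lambda>c. (gl_step \<alpha> \<beta> k s (\<theta> (a / real n)) f ^^ n) (\<psi> (a / real n)) c - Z a c)) \<longlonglongrightarrow> 0"
  shows "\<forall>\<^sub>F h in at_right 0. \<forall>m. real m * h \<le> D \<longrightarrow> gnorm ((gl_step \<alpha> \<beta> k s (\<theta> h) f' ^^ m) (\<psi> h)) \<le> R1 + 1"
proof -
  define w where "w h m = (gl_step \<alpha> \<beta> k s (\<theta> h) f' ^^ m) (\<psi> h)" for h m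
  define Cd where "Cd = drift_const * K"
  \<comment> \<open>A remainder of length \<open>2 * \<delta>\<close> has factors summing to at most
    \<open>4 * \<delta>\<close>, so its drift is at most 1.\<close>
  define \<delta> where "\<delta> = 1 / (4 * (Cd + 1))"
  have K: "0 \<le> K" using bd norm_ge_zero order_trans by blast
  have Cd: "0 \<le> Cd" using drift_const_nonneg K by (simp add: Cd_def)
  have \<delta>: "0 < \<delta>" "Cd * (4 * \<delta>) \<le> 1"
    using Cd by (auto simp: \<delta>_def field_simps)
  have slice: "\<forall>\<^sub>F h in at_right 0. \<forall>m. real m * h \<le> min (real j * \<delta>) D \<longrightarrow> gnorm (w h m) \<le> R1 + 1" for j
  proof (induction j)
    case 0
    have "\<forall>\<^sub>F h in at_right 0. gnorm (\<lambda>c. \<psi> h c - Z 0 c) < 1"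
      using \<psi> by (rule order_tendstoD) simp
    with eventually_at_right_less[of 0] show ?case
    proof eventually_elim
      case (elim h)
      have "m = 0" if "real m * h \<le> min (real 0 * \<delta>) D" for m
        using that elim D by (simp add: mult_le_0_iff)
      moreover have "gnorm (w h 0) \<le> R1 + 1"
        using gnorm_diff_triangle[of "\<psi> h" "Z 0"] Z[of 0] D elim by (auto simp: w_def)
      ultimately show ?case by metis
    qed
  next
    case (Suc j)
    let ?d = "min (real j * \<delta>) D" and ?d' = "min (real (Suc j) * \<delta>) D"
    have d': "0 < ?d'" "?d' \<le> D" "?d' \<le> ?d + \<delta>" "0 \<le> ?d" "?d \<le> ?d'"
      using \<delta> D by (auto simp: distrib_right add_pos_nonneg)
    have "\<forall>\<^sub>F h in at_right 0. 0 < h \<and> h < \<delta>"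
      using \<delta>(1) by (rule eventually_at_right_0_less)
    \<comment> \<open>The bound \<open>R1 + 1\<close> at the cut and a drift of at most 1 keep the
      run in the ball where \<open>f'\<close> and \<open>f\<close> agree.\<close>
    with Suc \<theta> have "\<forall>\<^sub>F h in at_right 0. \<forall>m. real m * h \<le> ?d' \<longrightarrow> gnorm (w h m) \<le> R1 + 2"
    proof eventually_elim
      case (elim h)
      show ?case
      proof (intro allI impI)
        fix m assume m: "real m * h \<le> ?d'"
        have h: "0 < h" "h \<le> \<delta>" and md: "real m * h \<le> ?d + \<delta>"
          using elim m d'(3) by linarith+
        obtain i where i: "i \<le> m" "real i * h \<le> ?d" "real (m - i) * h \<le> 2 * \<delta>"
          by (rule split_steps[OF h d'(4) md])
        have "w h m = (gl_step \<alpha> \<beta> k s (\<theta> h) f' ^^ (m - i)) (w h i)"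
          using i(1) by (simp add: w_def flip: funpow_add[THEN fun_cong, unfolded comp_def])
        then have "gnorm (w h m) \<le> gnorm (w h i) + Cd * (real (m - i) * \<theta> h)"
          unfolding Cd_def using elim by (auto intro: gnorm_iter_le bd)
        moreover have "gnorm (w h i) \<le> R1 + 1" using elim i by blast
        moreover have "real (m - i) * \<theta> h \<le> real (m - i) * (2 * h)"
          using elim by (intro mult_left_mono) auto
        then have "real (m - i) * \<theta> h \<le> 4 * \<delta>" using i(3) by linarith
        then have "Cd * (real (m - i) * \<theta> h) \<le> Cd * (4 * \<delta>)" using Cd by (rule mult_left_mono)
        ultimately show "gnorm (w h m) \<le> R1 + 2"
          using \<delta>(2) by linarith
      qed
    qed
    then show ?case
      unfolding w_def using d'(2)
      by (intro gnorm_uniform_bound[where f=f and f'=f' and Z=Z and \<theta>=\<theta>, OF eq lip bd L d'(1) \<theta> C _ \<psi>] Z conv) auto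
  qed
  \<comment> \<open>Finitely many slices cover the interval, so one threshold for the stepsize
    serves them all.\<close>
  obtain j where "D / \<delta> \<le> real j" using real_arch_simple by blast
  then have "min (real j * \<delta>) D = D" using \<delta> by (simp add: field_simps)
  with slice[of j] show ?thesis unfolding w_def by simp
qed

section \<open>Transfer of convergence between factors\<close>

lemma gnorm_tendsto_0:
  assumes "\<And>c. c \<in> blocks k s \<Longrightarrow> ((\<lambda>x. g x c) \<longlongrightarrow> 0) F"
  shows "((\<lambda>x. gnorm (g x)) \<longlongrightarrow> 0) F"
proof (rule Lim_null_comparison)
  let ?c = "1 + real (depth k) * (real (s+1) * wt)"
  show "\<forall>\<^sub>F x in F. norm (gnorm (g x)) \<le> ?c * (\<Sum>c\<in>blocks k s. norm (g x c))"
    unfolding real_norm_def abs_of_nonneg[OF gnorm_nonneg] by (intro always_eventually allI gnorm_le_sum)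
  have "((\<lambda>x. ?c * (\<Sum>c\<in>blocks k s. norm (g x c))) \<longlongrightarrow> ?c * (\<Sum>c\<in>blocks k s. 0)) F"
    using assms by (intro tendsto_intros tendsto_sum tendsto_norm_zero) auto
  then show "((\<lambda>x. ?c * (\<Sum>c\<in>blocks k s. norm (g x c))) \<longlongrightarrow> 0) F"
    by simp
qed

lemma gnorm_diff_self: "gnorm (\<lambda>c. g c - g c :: 'v::real_normed_vector) = 0"
  using gnorm_le_sum[of "\<lambda>_. 0 :: 'v"] gnorm_nonneg[of "\<lambda>_. 0 :: 'v"] by simp

text \<open>The same \<open>u\<close> and \<open>\<psi>\<close> serve both factors.\<close>

lemma gl_convergent_transfer:
  assumes \<theta>: "(\<lambda>h. \<theta> h - h) \<in> O[at_right 0](\<lambda>h. h\<^sup>2)" and \<theta>': "(\<lambda>h. \<theta>' h - h) \<in> O[at_right 0](\<lambda>h. h\<^sup>2)"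
    and conv: "gl_convergent TYPE('N::finite) \<alpha> \<beta> k s \<theta>"
  shows "gl_convergent TYPE('N) \<alpha> \<beta> k s \<theta>'"
  unfolding gl_convergent_def
proof (intro allI impI)
  fix f :: "real^'N \<Rightarrow> real^'N" and t0 T x0 x
  assume adm: "admissible_ivp f t0 T x0 x"
  with conv obtain u :: "block \<Rightarrow> real" and \<psi> :: "real \<Rightarrow> block \<Rightarrow> real^'N" where
    u: "\<exists>c\<in>blocks k s. u c \<noteq> 0"
    and \<psi>: "\<forall>c\<in>blocks k s. ((\<lambda>h. \<psi> h c) \<longlongrightarrow> u c *\<^sub>R x t0) (at_right 0)"
    and lim: "\<forall>t\<in>{t0<..T}. \<forall>c\<in>blocks k s. (\<lambda>n. let h = (t - t0) / real n in
                 (gl_step \<alpha> \<beta> k s (\<theta> h) f ^^ n) (\<psi> h) c) \<longlonglongrightarrow> u c *\<^sub>R x t"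
    unfolding gl_convergent_def by blast
  define D where "D = T - t0"
  define Z where "Z a c = u c *\<^sub>R x (t0 + a)" for a c
  have D: "0 < D" using adm by (simp add: admissible_ivp_def D_def)
  obtain M where M: "\<And>t. t \<in> {t0..T} \<Longrightarrow> norm (x t) \<le> M"
    using adm unfolding admissible_ivp_def by blast
  define R1 where "R1 = (1 + real (depth k) * (real (s+1) * wt)) * (\<Sum>c\<in>blocks k s. \<bar>u c\<bar> * M)"
  have Z: "gnorm (Z a) \<le> R1" if "0 \<le> a" "a \<le> D" for a
  proof -
    have "(\<Sum>c\<in>blocks k s. norm (Z a c)) \<le> (\<Sum>c\<in>blocks k s. \<bar>u c\<bar> * M)"
      unfolding Z_def using M that by (intro sum_mono) (auto simp: D_def intro: mult_left_mono)
    then show ?thesis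
      unfolding R1_def using wt_pos gnorm_le_sum[of "Z a"]
      by (meson mult_left_mono order_trans add_nonneg_nonneg zero_le_one mult_nonneg_nonneg of_nat_0_le_iff less_imp_le)
  qed
  \<comment> \<open>The convergent run takes up \<open>R1 + 1\<close>; the remaining unit is room
    for the run with the other factor.\<close>
  define R where "R = R1 + 2"
  have R: "0 \<le> R" using Z[of 0] gnorm_nonneg[of "Z 0"] D by (simp add: R_def)
  have "local_lipschitz {t0..T} UNIV (\<lambda>_. f)" using adm by (simp add: admissible_ivp_def)
  then have "local_lipschitz {t0..T} (cball 0 R) (\<lambda>_. f)" by (rule local_lipschitz_subset) auto
  then obtain L where L_lip: "\<And>t. t \<in> {t0..T} \<Longrightarrow> L-lipschitz_on (cball 0 R) f"
    by (rule local_lipschitz_compact_implies_lipschitz[of "{t0..T}" "cball 0 R" "\<lambda>_. f"]) auto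
  have lip: "L-lipschitz_on (cball 0 R) f" by (rule L_lip[of T]) (use D in \<open>simp add: D_def\<close>)
  have L: "0 \<le> L" using lip by (rule lipschitz_on_nonneg)
  \<comment> \<open>Projection onto the ball is 1-Lipschitz, so \<open>f'\<close> inherits the
    constant \<open>L\<close> on the whole space, is bounded, and equals \<open>f\<close> on the
    ball.\<close>
  define f' where "f' z = f (closest_point (cball 0 R) z)" for z
  have cp: "closest_point (cball 0 R) z \<in> cball 0 R" for z :: "real^'N"
    using R by (intro closest_point_in_set) auto
  have eq: "f' z = f z" if "norm z \<le> R1 + 2" for z
    using that by (simp add: f'_def R_def closest_point_self)
  have lip': "norm (f' y - f' z) \<le> L * norm (y - z)" for y z
  proof -
    have "norm (f' y - f' z) \<le> L * dist (closest_point (cball 0 R) y) (closest_point (cball 0 R) z)"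
      unfolding f'_def dist_norm[symmetric] using lip cp by (rule lipschitz_onD) (rule cp)
    also have "\<dots> \<le> L * dist y z"
      using R L by (intro mult_left_mono closest_point_lipschitz) auto
    finally show ?thesis by (simp add: dist_norm)
  qed
  define K where "K = norm (f 0) + L * R"
  have bd: "norm (f' z) \<le> K" for z
  proof -
    have "dist (f (closest_point (cball 0 R) z)) (f 0) \<le> L * dist (closest_point (cball 0 R) z) 0"
      using R by (intro lipschitz_onD[OF lip] cp) auto
    also have "\<dots> \<le> L * R" using cp[of z] L by (intro mult_left_mono) auto
    finally show ?thesis
      unfolding f'_def K_def dist_norm using norm_triangle_sub[of "f (closest_point (cball 0 R) z)" "f 0"] by linarith
  qed
  obtain C where C: "0 < C"
    and \<theta>C: "\<forall>\<^sub>F h in at_right 0. 0 \<le> \<theta> h \<and> \<theta> h \<le> 2 * h \<and> \<bar>\<theta> h - h\<bar> \<le> C * h\<^sup>2"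
    using factor_bounds[OF \<theta>] .
  obtain C' where C': "0 < C'"
    and \<theta>C': "\<forall>\<^sub>F h in at_right 0. 0 \<le> \<theta>' h \<and> \<theta>' h \<le> 2 * h \<and> \<bar>\<theta>' h - h\<bar> \<le> C' * h\<^sup>2"
    using factor_bounds[OF \<theta>'] .
  define w where "w h m = (gl_step \<alpha> \<beta> k s (\<theta> h) f' ^^ m) (\<psi> h)" for h m
  define w' where "w' h m = (gl_step \<alpha> \<beta> k s (\<theta>' h) f' ^^ m) (\<psi> h)" for h m
  have run: "\<forall>\<^sub>F h in at_right 0. \<forall>m. real m * h \<le> D \<longrightarrow> gnorm (w h m) \<le> R1 + 1"
    unfolding w_def
  proof (rule gnorm_run_bound[where f=f and f'=f' and Z=Z and \<theta>=\<theta>, OF eq lip' bd L D \<theta>C])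
    show "((\<lambda>h. gnorm (\<lambda>c. \<psi> h c - Z 0 c)) \<longlongrightarrow> 0) (at_right 0)"
      unfolding Z_def using \<psi> by (intro gnorm_tendsto_0 LIM_zero) simp
    fix a assume a: "0 < a" "a \<le> D"
    then have t: "t0 + a \<in> {t0<..T}" by (simp add: D_def)
    show "(\<lambda>n. gnorm (\<lambda>c. (gl_step \<alpha> \<beta> k s (\<theta> (a / real n)) f ^^ n) (\<psi> (a / real n)) c - Z a c)) \<longlonglongrightarrow> 0"
      unfolding Z_def using lim[rule_format, OF t] by (intro gnorm_tendsto_0 LIM_zero) (simp add: Let_def)
  qed (use C Z in auto)
  \<comment> \<open>Up to time \<open>D\<close> there are at most \<open>D / h\<close> steps, each
    with factors differing by at most \<open>(C + C') * h\<^sup>2\<close>.\<close>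
  define B where "B = exp (lip_const * L * (2 * D)) * (drift_const * K * (D * (C + C')))"
  have K: "0 \<le> K" using bd norm_ge_zero order_trans by blast
  have dK: "0 \<le> drift_const * K" using drift_const_nonneg K by simp
  have close: "\<forall>\<^sub>F h in at_right 0. \<forall>m. real m * h \<le> D \<longrightarrow> gnorm (\<lambda>c. w h m c - w' h m c) \<le> B * h"
    using \<theta>C \<theta>C' eventually_at_right_less[of 0]
  proof eventually_elim
    case (elim h)
    show ?case
    proof (intro allI impI)
      fix m assume m: "real m * h \<le> D"
      have "real m * \<theta> h \<le> real m * (2 * h)" using elim by (intro mult_left_mono) auto
      also have "\<dots> \<le> 2 * D" using m by simp
      finally have E: "exp (lip_const * L * (real m * \<theta> h)) \<le> exp (lip_const * L * (2 * D))"
        using lip_const_nonneg L by (simp add: mult_left_mono)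
      have "real m * \<bar>\<theta> h - \<theta>' h\<bar> \<le> real m * ((C + C') * h\<^sup>2)"
        using elim by (intro mult_left_mono) (auto simp: distrib_right)
      also have "\<dots> = (real m * h) * ((C + C') * h)" by (simp add: power2_eq_square)
      also have "\<dots> \<le> D * ((C + C') * h)" using m C C' elim by (intro mult_right_mono) auto
      finally have "drift_const * K * (real m * \<bar>\<theta> h - \<theta>' h\<bar>) \<le> drift_const * K * (D * ((C + C') * h))"
        using dK by (intro mult_left_mono)
      moreover have "gnorm (\<lambda>c. w h m c - w' h m c) \<le> exp (lip_const * L * (real m * \<theta> h))
          * (gnorm (\<lambda>c. \<psi> h c - \<psi> h c) + drift_const * K * (real m * \<bar>\<theta> h - \<theta>' h\<bar>))"
        unfolding w_def w'_def using elim by (intro gnorm_iter_diff lip' bd L) auto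
      moreover have "0 \<le> drift_const * K * (real m * \<bar>\<theta> h - \<theta>' h\<bar>)"
        by (rule mult_nonneg_nonneg[OF dK]) simp
      ultimately have "gnorm (\<lambda>c. w h m c - w' h m c)
          \<le> exp (lip_const * L * (2 * D)) * (drift_const * K * (D * ((C + C') * h)))"
        using E unfolding gnorm_diff_self by (smt (verit) mult_mono exp_ge_zero)
      then show "gnorm (\<lambda>c. w h m c - w' h m c) \<le> B * h"
        by (simp add: B_def mult.assoc)
    qed
  qed
  have "((\<lambda>h. B * h) \<longlongrightarrow> B * 0) (at_right 0)" by (intro tendsto_intros)
  \<comment> \<open>Below this threshold the second run also stays within \<open>R\<close>, so both
    runs with \<open>f'\<close> coincide with those of \<open>f\<close>.\<close>
  then have "\<forall>\<^sub>F h in at_right 0. B * h < 1" by (rule order_tendstoD) simp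
  with run close have good: "\<forall>\<^sub>F h in at_right 0. \<forall>m. real m * h \<le> D \<longrightarrow>
      gnorm (w h m) \<le> R \<and> gnorm (w' h m) \<le> R \<and> gnorm (\<lambda>c. w' h m c - w h m c) \<le> B * h"
  proof eventually_elim
    case (elim h)
    show ?case
    proof (intro allI impI)
      fix m assume m: "real m * h \<le> D"
      have "gnorm (w h m) \<le> R1 + 1" "gnorm (\<lambda>c. w' h m c - w h m c) \<le> B * h"
        using elim m gnorm_minus_commute[of "w h m" "w' h m"] by auto
      then show "gnorm (w h m) \<le> R \<and> gnorm (w' h m) \<le> R \<and> gnorm (\<lambda>c. w' h m c - w h m c) \<le> B * h"
        using gnorm_diff_triangle[of "w' h m" "w h m"] elim by (simp add: R_def)
    qed
  qed
  have "(\<lambda>n. let h = (t - t0) / real n in (gl_step \<alpha> \<beta> k s (\<theta>' h) f ^^ n) (\<psi> h) c) \<longlonglongrightarrow> u c *\<^sub>R x t"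
    if t: "t \<in> {t0<..T}" and c: "c \<in> blocks k s" for t c
  proof (rule Lim_transform)
    let ?h = "\<lambda>n. (t - t0) / real n"
    show "(\<lambda>n. let h = ?h n in (gl_step \<alpha> \<beta> k s (\<theta> h) f ^^ n) (\<psi> h) c) \<longlonglongrightarrow> u c *\<^sub>R x t"
      using lim t c by blast
    have "filterlim ?h (at_right 0) sequentially"
      using t by (intro stepsize_at_right) auto
    from eventually_compose_filterlim[OF good this] eventually_gt_at_top[of 0]
    have "\<forall>\<^sub>F n in sequentially. norm ((let h = ?h n in (gl_step \<alpha> \<beta> k s (\<theta>' h) f ^^ n) (\<psi> h) c)
        - (let h = ?h n in (gl_step \<alpha> \<beta> k s (\<theta> h) f ^^ n) (\<psi> h) c)) \<le> B * ?h n"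
    proof eventually_elim
      case (elim n)
      have m: "real m * ?h n \<le> D" if "m \<le> n" for m
      proof -
        have "real m * ?h n \<le> real n * ?h n" using that t by (intro mult_right_mono) auto
        also have "\<dots> \<le> D" using elim t by (simp add: D_def)
        finally show ?thesis .
      qed
      have "(gl_step \<alpha> \<beta> k s (\<theta>' (?h n)) f ^^ n) (\<psi> (?h n)) c = w' (?h n) n c"
        unfolding w'_def using elim m c
        by (intro gl_iter_cong[where R=R] eq) (auto simp: w'_def R_def)
      moreover have "(gl_step \<alpha> \<beta> k s (\<theta> (?h n)) f ^^ n) (\<psi> (?h n)) c = w (?h n) n c"
        unfolding w_def using elim m c
        by (intro gl_iter_cong[where R=R] eq) (auto simp: w_def R_def)
      moreover have "norm (w' (?h n) n c - w (?h n) n c) \<le> B * ?h n"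
        using norm_le_gnorm[OF c, of "\<lambda>c. w' (?h n) n c - w (?h n) n c"] elim(1)[rule_format, OF m[of n]]
        by (meson order_refl order_trans)
      ultimately show ?case by (simp add: Let_def)
    qed
    moreover have "(\<lambda>n. B * ?h n) \<longlonglongrightarrow> 0"
      using lim_const_over_n[of "B * (t - t0)"] by simp
    ultimately show "(\<lambda>n. (let h = ?h n in (gl_step \<alpha> \<beta> k s (\<theta>' h) f ^^ n) (\<psi> h) c)
        - (let h = ?h n in (gl_step \<alpha> \<beta> k s (\<theta> h) f ^^ n) (\<psi> h) c)) \<longlonglongrightarrow> 0"
      by (rule Lim_null_comparison)
  qed
  with u \<psi> show "\<exists>u \<psi>. (\<exists>c\<in>blocks k s. u c \<noteq> 0) \<and>
      (\<forall>c\<in>blocks k s. ((\<lambda>h. \<psi> h c) \<longlongrightarrow> u c *\<^sub>R x t0) (at_right 0)) \<and>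
      (\<forall>t\<in>{t0<..T}. \<forall>c\<in>blocks k s.
         (\<lambda>n. let h = (t - t0) / real n in (gl_step \<alpha> \<beta> k s (\<theta>' h) f ^^ n) (\<psi> h) c) \<longlonglongrightarrow> u c *\<^sub>R x t)"
    by (intro exI[of _ u] exI[of _ \<psi>] conjI ballI) auto
qed

end

section \<open>Row sums from covariance, and the conclusion\<close>

lemma gl_covariant_row_sum:
  assumes cov: "gl_covariant TYPE('N::finite) \<alpha> \<beta> k s \<theta>" and i: "i \<in> {2..s+1}"
  shows "(\<Sum>l=2..k. \<Sum>j=1..s. \<alpha> l i j) + (\<Sum>j=1..<i. \<alpha> 1 i j) = 1"
proof -
  define \<eta> :: "real^'N" where "\<eta> = 1"
  have \<eta>: "\<eta> \<noteq> 0" by (simp add: \<eta>_def)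
  obtain u :: "block \<Rightarrow> real" where u: "\<And>(f :: real^'N \<Rightarrow> real^'N) \<eta> h g1 g2. h > 0 \<Longrightarrow>
        (\<forall>b\<in>blocks k s. g2 b = g1 b + u b *\<^sub>R \<eta>) \<Longrightarrow>
        (\<forall>b\<in>blocks k s. gl_step \<alpha> \<beta> k s (\<theta> h) (\<lambda>z. f (z - \<eta>)) g2 b
                        = gl_step \<alpha> \<beta> k s (\<theta> h) f g1 b + u b *\<^sub>R \<eta>) \<and>
        (\<forall>i\<in>{1..s+1}. gl_stage \<alpha> \<beta> k s (\<theta> h) (\<lambda>z. f (z - \<eta>)) g2 i
                        = gl_stage \<alpha> \<beta> k s (\<theta> h) f g1 i + \<eta>)"
    using cov unfolding gl_covariant_def by blast
  \<comment> \<open>Covariance is applied with \<open>f = 0\<close> to the zero vector, whose run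
    vanishes; \<open>g\<close> is its shifted counterpart, and its blocks have to be determined
    since \<open>u\<close> is arbitrary.\<close>
  define g where "g c = u c *\<^sub>R \<eta>" for c
  let ?stage = "gl_stage \<alpha> \<beta> k s (\<theta> 1) (\<lambda>_. 0 :: real^'N)"
  let ?step = "gl_step \<alpha> \<beta> k s (\<theta> 1) (\<lambda>_. 0 :: real^'N)"
  have zero: "?stage (\<lambda>_. 0) i = 0" for i
    by (induction i rule: less_induct) (subst gl_stage.simps, simp)
  have stage: "?stage g i = \<eta>" if "i \<in> {1..s+1}" for i
    using u[of 1 g "\<lambda>_. 0" \<eta> "\<lambda>_. 0"] that by (simp add: zero g_def)
  have step: "?step g c = ?step (\<lambda>_. 0) c + g c" if "c \<in> blocks k s" for c
    using u[of 1 g "\<lambda>_. 0" \<eta> "\<lambda>_. 0"] that by (simp add: g_def)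
  \<comment> \<open>Covariance of the step identifies \<open>g (Val 0 j)\<close> with the
    \<open>j\<close>-th stage, which is \<open>\<eta>\<close>, and each older block with the one a
    step younger. The slopes follow the same pattern from 0.\<close>
  have val: "g (Val q j) = \<eta>" if "q < depth k" "j \<in> {1..s+1}" for q j
    using that
  proof (induction q)
    case 0
    then have "Val 0 j \<in> blocks k s" by (auto simp: blocks_def)
    from step[OF this] show ?case using stage 0 by (simp add: zero)
  next
    case (Suc q)
    then have "Val (Suc q) j \<in> blocks k s" by (auto simp: blocks_def)
    from step[OF this] show ?case using Suc by simp
  qed
  have slope: "g (Slope q j) = 0" if "q < depth k" "j \<in> {1..s+1}" for q j
    using that
  proof (induction q)
    case 0
    then have "Slope 0 j \<in> blocks k s" by (auto simp: blocks_def)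
    from step[OF this] show ?case by simp
  next
    case (Suc q)
    then have "Slope (Suc q) j \<in> blocks k s" by (auto simp: blocks_def)
    from step[OF this] show ?case using Suc by simp
  qed
  have "\<eta> = ?stage g i" using i by (simp add: stage)
  also have "\<dots> = (\<Sum>l=2..k. \<Sum>j=1..s. \<alpha> l i j *\<^sub>R g (Val (l-2) j) + \<beta> l i j *\<^sub>R g (Slope (l-2) j))
      + (\<Sum>j=1..<i. \<alpha> 1 i j *\<^sub>R ?stage g j)"
    using i by (subst gl_stage.simps) simp
  also have "\<dots> = (\<Sum>l=2..k. \<Sum>j=1..s. \<alpha> l i j *\<^sub>R \<eta>) + (\<Sum>j=1..<i. \<alpha> 1 i j *\<^sub>R \<eta>)"
    using i by (intro arg_cong2[where f="(+)"] sum.cong refl) (auto simp: val slope stage depth_def)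
  also have "\<dots> = ((\<Sum>l=2..k. \<Sum>j=1..s. \<alpha> l i j) + (\<Sum>j=1..<i. \<alpha> 1 i j)) *\<^sub>R \<eta>"
    by (simp add: scaleR_sum_left scaleR_add_left)
  finally have "1 *\<^sub>R \<eta> = ((\<Sum>l=2..k. \<Sum>j=1..s. \<alpha> l i j) + (\<Sum>j=1..<i. \<alpha> 1 i j)) *\<^sub>R \<eta>" by simp
  then show ?thesis using \<eta> by (simp only: scaleR_cancel_right) simp
qed

theorem theorem4:
  fixes k s :: nat and \<alpha> \<beta> :: coeffs and \<phi> :: "real \<Rightarrow> real"
  assumes "k \<ge> 1" and "s \<ge> 1"
    and "nonneg_coeffs k s \<alpha>" and "nonneg_coeffs k s \<beta>"
    and "\<phi> C1_differentiable_on UNIV"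
    and "(\<lambda>h. \<phi> h - h) \<in> O[at 0](\<lambda>h. h\<^sup>2)"
    and "gl_covariant TYPE('N::finite) \<alpha> \<beta> k s \<phi>"
    and "gl_covariant TYPE('N) \<alpha> \<beta> k s (\<lambda>h. h)"
  shows "gl_convergent TYPE('N) \<alpha> \<beta> k s \<phi> \<longleftrightarrow> gl_convergent TYPE('N) \<alpha> \<beta> k s (\<lambda>h. h)"
proof -
  let ?I = "{1..k} \<times> {2..s+1} \<times> {1..s+1}"
  \<comment> \<open>The sum dominates every coefficient in the finite index box, and the summand 1
    secures \<open>1 \<le> b\<close>.\<close>
  define b where "b = 1 + (\<Sum>(l,i,j)\<in>?I. \<bar>\<beta> l i j\<bar>)"
  have \<beta>: "\<bar>\<beta> l i j\<bar> \<le> b" if "l \<in> {1..k}" "i \<in> {2..s+1}" "j \<in> {1..s+1}" for l i j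
    using member_le_sum[of "(l,i,j)" ?I "\<lambda>(l,i,j). \<bar>\<beta> l i j\<bar>"] that by (auto simp: b_def)
  interpret stochastic_method \<alpha> \<beta> k s b
  proof
    show "1 \<le> b" unfolding b_def by (auto intro: sum_nonneg)
  qed (use assms gl_covariant_row_sum[OF assms(8)] \<beta> in auto)
  have \<phi>: "(\<lambda>h. \<phi> h - h) \<in> O[at_right 0](\<lambda>h. h\<^sup>2)"
    using assms(6) by (rule landau_o.big.filter_mono[rotated]) (simp add: at_le)
  have id: "(\<lambda>h. h - h) \<in> O[at_right 0](\<lambda>h. (h::real)\<^sup>2)"
    by simp
  show ?thesis
    using gl_convergent_transfer[OF \<phi> id] gl_convergent_transfer[OF id \<phi>] by blast
qed

end
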